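(* Let $S$ be an infinite commutative domain satisfying: (1) for every finite set $A\subseteq S$ there exists $x\in S$, neither zero nor a unit, such that $(x)+(a_i)=S$ for every $a_i\in A\setminus\{0\}$; (2) for every finite set $A\subseteq S$ with $0\notin A$ and every $a\in S$ which is neither zero nor a unit, there exists $g\in S$ such that: for every $a_i\in A$, $1+a_ig$ is neither zero nor a unit; for every $a_i\in A$, $(a)+(1+a_ig)=S$; and for distinct $a_i,a_j\in A$, $(1+a_ig)+(1+a_jg)=S$. Consider any first-order structure on $S$ expanding its ring structure. If there exists a uniformly parametrizable family of subsets of $S$ (in this structure) that contains finite sets of arbitrarily large finite cardinality, then a model of the theory $R$ of Tarski, Mostowski and Robinson is interpretable in this structure. Consequently the first-order theory of this structure is undecidable.
   Context: A family $\mathcal{F}$ of subsets of $S$ is uniformly parametrizable (in a given structure on $S$) if there exist a definable set $C\subseteq S^k$ and a first-order formula $\varphi(x,y_1,\dots,y_k)$ such that for every $F\subseteq S$: $F\in\mathcal{F}$ iff there is $\bar y\in C$ with $F=\{x\in S: \varphi(x,\bar y)\}$. The theory $R$ of Tarski, Mostowski and Robinson is in the language $\{0,S,+,\cdot\}$ of arithmetic; writing $\Delta_0=0$, $\Delta_{n+1}=S(\Delta_n)$ and $\alpha\le\beta$ for $\exists w\,(w+\alpha=\beta)$, its axioms are, for all natural numbers $n,m$: $\Delta_n+\Delta_m=\Delta_{n+m}$; $\Delta_n\cdot\Delta_m=\Delta_{nm}$; $\Delta_n\neq\Delta_m$ for $n\neq m$; $\forall x\,(x\le\Delta_n\to x=\Delta_0\vee\dots\vee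 x=\Delta_n)$; $\forall x\,(x\le\Delta_n\vee\Delta_n\le x)$. Every model of $R$ has undecidable theory. *)

theory Defs
  imports Main "HOL-Library.Nat_Bijection"
begin

definition comaximal :: "'a::comm_ring_1 \<Rightarrow> 'a \<Rightarrow> bool" where
  "comaximal x y \<longleftrightarrow> {u * x + v * y | u v. True} = UNIV"

definition cond1 :: "'a::idom itself \<Rightarrow> bool" where
  "cond1 _ \<longleftrightarrow> (\<forall>A::'a set. finite A \<longrightarrow>
     (\<exists>x. x \<noteq> 0 \<and> \<not> x dvd 1 \<and> (\<forall>a\<in>A - {0}. comaximal x a)))"

definition cond2 :: "'a::idom itself \<Rightarrow> bool" where
  "cond2 _ \<longleftrightarrow> (\<forall>(A::'a set) a. finite A \<longrightarrow> 0 \<notin> A \<longrightarrow> a \<noteq> 0 \<longrightarrow> \<not> a dvd 1 \<longrightarrow>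
     (\<exists>g. (\<forall>ai\<in>A. 1 + ai * g \<noteq> 0 \<and> \<not> (1 + ai * g) dvd 1)
        \<and> (\<forall>ai\<in>A. comaximal a (1 + ai * g))
        \<and> (\<forall>ai\<in>A. \<forall>aj\<in>A. ai \<noteq> aj \<longrightarrow> comaximal (1 + ai * g) (1 + aj * g))))"

datatype 'f trm = Var nat | Fn 'f "'f trm list"

datatype ('f, 'p) fm =
    FF
  | Eq "'f trm" "'f trm"
  | Rel 'p "'f trm list"
  | Imp "('f, 'p) fm" "('f, 'p) fm"
  | Ex nat "('f, 'p) fm"

fun wf_trm :: "('f \<Rightarrow> nat) \<Rightarrow> 'f trm \<Rightarrow> bool" where
  "wf_trm ar (Var i) = True"
| "wf_trm ar (Fn f ts) = (length ts = ar f \<and> (\<forall>t\<in>set ts. wf_trm ar t))"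

fun wf_fm :: "('f \<Rightarrow> nat) \<Rightarrow> ('p \<Rightarrow> nat) \<Rightarrow> ('f, 'p) fm \<Rightarrow> bool" where
  "wf_fm ar par FF = True"
| "wf_fm ar par (Eq s t) = (wf_trm ar s \<and> wf_trm ar t)"
| "wf_fm ar par (Rel p ts) = (length ts = par p \<and> (\<forall>t\<in>set ts. wf_trm ar t))"
| "wf_fm ar par (Imp a b) = (wf_fm ar par a \<and> wf_fm ar par b)"
| "wf_fm ar par (Ex i a) = wf_fm ar par a"

fun fv_trm :: "'f trm \<Rightarrow> nat set" where
  "fv_trm (Var i) = {i}"
| "fv_trm (Fn f ts) = (\<Union>t\<in>set ts. fv_trm t)"

fun fv_fm :: "('f, 'p) fm \<Rightarrow> nat set" where
  "fv_fm FF = {}"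
| "fv_fm (Eq s t) = fv_trm s \<union> fv_trm t"
| "fv_fm (Rel p ts) = (\<Union>t\<in>set ts. fv_trm t)"
| "fv_fm (Imp a b) = fv_fm a \<union> fv_fm b"
| "fv_fm (Ex i a) = fv_fm a - {i}"

text \<open>Semantics in a structure with universe UNIV :: 'a set, function
  interpretation FI and relation interpretation PI (only applied to argument
  lists of the right length in well-formed formulas).\<close>

fun teval :: "('f \<Rightarrow> 'a list \<Rightarrow> 'a) \<Rightarrow> (nat \<Rightarrow> 'a) \<Rightarrow> 'f trm \<Rightarrow> 'a" where
  "teval FI e (Var i) = e i"
| "teval FI e (Fn f ts) = FI f (map (teval FI e) ts)"

fun sat :: "('f \<Rightarrow> 'a list \<Rightarrow> 'a) \<Rightarrow> ('p \<Rightarrow> 'a list \<Rightarrow> bool) \<Rightarrow> (nat \<Rightarrow> 'a)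
             \<Rightarrow> ('f, 'p) fm \<Rightarrow> bool" where
  "sat FI PI e FF = False"
| "sat FI PI e (Eq s t) = (teval FI e s = teval FI e t)"
| "sat FI PI e (Rel p ts) = PI p (map (teval FI e) ts)"
| "sat FI PI e (Imp a b) = (sat FI PI e a \<longrightarrow> sat FI PI e b)"
| "sat FI PI e (Ex i a) = (\<exists>x. sat FI PI (e(i := x)) a)"

definition env_of :: "'a list \<Rightarrow> (nat \<Rightarrow> 'a) \<Rightarrow> nat \<Rightarrow> 'a" where
  "env_of xs e i = (if i < length xs then xs ! i else e i)"

definition expands_ring :: "('f \<Rightarrow> nat) \<Rightarrow> ('f \<Rightarrow> 'a::comm_ring_1 list \<Rightarrow> 'a) \<Rightarrow> bool" where
  "expands_ring ar FI \<longleftrightarrow> (\<exists>fadd fneg fmul fzero fone.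
      ar fadd = 2 \<and> ar fneg = 1 \<and> ar fmul = 2 \<and> ar fzero = 0 \<and> ar fone = 0 \<and>
      (\<forall>x y. FI fadd [x, y] = x + y) \<and> (\<forall>x. FI fneg [x] = - x) \<and>
      (\<forall>x y. FI fmul [x, y] = x * y) \<and> FI fzero [] = 0 \<and> FI fone [] = 1)"

text \<open>Uniformly parametrizable family (definability with parameters, given by e):
  C = {ys. length ys = k \<and> psi(ys)}, and F \<in> \<F> iff F = {x. phi(x, ys)} for some ys \<in> C.\<close>
definition unif_param :: "('f \<Rightarrow> nat) \<Rightarrow> ('p \<Rightarrow> nat) \<Rightarrow> ('f \<Rightarrow> 'a list \<Rightarrow> 'a)
    \<Rightarrow> ('p \<Rightarrow> 'a list \<Rightarrow> bool) \<Rightarrow> 'a set set \<Rightarrow> bool" where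
  "unif_param ar par FI PI \<F> \<longleftrightarrow>
    (\<exists>k (psi :: ('f, 'p) fm) (phi :: ('f, 'p) fm) e. wf_fm ar par psi \<and> wf_fm ar par phi \<and>
       (let C = {ys. length ys = k \<and> sat FI PI (env_of ys e) psi} in
        \<forall>F. F \<in> \<F> \<longleftrightarrow> (\<exists>ys\<in>C. F = {x. sat FI PI (env_of (x # ys) e) phi})))"

primrec numeral_R :: "'b \<Rightarrow> ('b \<Rightarrow> 'b) \<Rightarrow> nat \<Rightarrow> 'b" where
  "numeral_R z s 0 = z"
| "numeral_R z s (Suc n) = s (numeral_R z s n)"

definition setoid_model_R :: "'b set \<Rightarrow> ('b \<Rightarrow> 'b \<Rightarrow> bool) \<Rightarrow> 'b \<Rightarrow> ('b \<Rightarrow> 'b)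
    \<Rightarrow> ('b \<Rightarrow> 'b \<Rightarrow> 'b) \<Rightarrow> ('b \<Rightarrow> 'b \<Rightarrow> 'b) \<Rightarrow> bool" where
  "setoid_model_R D E z s a m \<longleftrightarrow>
    (\<forall>x\<in>D. E x x) \<and> (\<forall>x\<in>D. \<forall>y\<in>D. E x y \<longrightarrow> E y x) \<and>
    (\<forall>x\<in>D. \<forall>y\<in>D. \<forall>w\<in>D. E x y \<longrightarrow> E y w \<longrightarrow> E x w) \<and>
    z \<in> D \<and> (\<forall>x\<in>D. s x \<in> D) \<and> (\<forall>x\<in>D. \<forall>y\<in>D. a x y \<in> D \<and> m x y \<in> D) \<and>
    (\<forall>x\<in>D. \<forall>x'\<in>D. E x x' \<longrightarrow> E (s x) (s x')) \<and>
    (\<forall>x\<in>D. \<forall>x'\<in>D. \<forall>y\<in>D. \<forall>y'\<in>D. E x x' \<longrightarrow> E y y' \<longrightarrow>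
        E (a x y) (a x' y') \<and> E (m x y) (m x' y')) \<and>
    (let \<Delta> = numeral_R z s; le = (\<lambda>u v. \<exists>w\<in>D. E (a w u) v) in
      (\<forall>n k. E (a (\<Delta> n) (\<Delta> k)) (\<Delta> (n + k))) \<and>
      (\<forall>n k. E (m (\<Delta> n) (\<Delta> k)) (\<Delta> (n * k))) \<and>
      (\<forall>n k. n \<noteq> k \<longrightarrow> \<not> E (\<Delta> n) (\<Delta> k)) \<and>
      (\<forall>n. \<forall>x\<in>D. le x (\<Delta> n) \<longrightarrow> (\<exists>i\<le>n. E x (\<Delta> i))) \<and>
      (\<forall>n. \<forall>x\<in>D. le x (\<Delta> n) \<or> le (\<Delta> n) x))"

text \<open>A model of R is interpretable (with parameters e) in the structure:
  domain formula dD in n variables, equality formula dE, and formulas for the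
  graphs of 0, S, +, * (defining the induced operations modulo dE).\<close>
definition interprets_R :: "('f \<Rightarrow> nat) \<Rightarrow> ('p \<Rightarrow> nat) \<Rightarrow> ('f \<Rightarrow> 'a list \<Rightarrow> 'a)
    \<Rightarrow> ('p \<Rightarrow> 'a list \<Rightarrow> bool) \<Rightarrow> bool" where
  "interprets_R ar par FI PI \<longleftrightarrow>
    (\<exists>n (dD :: ('f, 'p) fm) dE dZ dS dA dM e. n \<ge> 1 \<and>
       wf_fm ar par dD \<and> wf_fm ar par dE \<and> wf_fm ar par dZ \<and> wf_fm ar par dS \<and>
       wf_fm ar par dA \<and> wf_fm ar par dM \<and>
       (let D = {xs. length xs = n \<and> sat FI PI (env_of xs e) dD};
            E = (\<lambda>xs ys. sat FI PI (env_of (xs @ ys) e) dE) in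
        \<exists>z s a m. setoid_model_R D E z s a m \<and>
          (\<forall>x\<in>D. sat FI PI (env_of x e) dZ \<longleftrightarrow> E z x) \<and>
          (\<forall>x\<in>D. \<forall>y\<in>D. sat FI PI (env_of (x @ y) e) dS \<longleftrightarrow> E (s x) y) \<and>
          (\<forall>x\<in>D. \<forall>y\<in>D. \<forall>w\<in>D. sat FI PI (env_of (x @ y @ w) e) dA \<longleftrightarrow> E (a x y) w) \<and>
          (\<forall>x\<in>D. \<forall>y\<in>D. \<forall>w\<in>D. sat FI PI (env_of (x @ y @ w) e) dM \<longleftrightarrow> E (m x y) w)))"

datatype recf = Zr | Sc | Pj nat | Cn recf "recf list" | Pr recf recf | Mn recf

inductive reval :: "recf \<Rightarrow> nat list \<Rightarrow> nat \<Rightarrow> bool" where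
  "reval Zr xs 0"
| "reval Sc (x # xs) (Suc x)"
| "i < length xs \<Longrightarrow> reval (Pj i) xs (xs ! i)"
| "length ys = length fs \<Longrightarrow> (\<forall>i<length fs. reval (fs ! i) xs (ys ! i)) \<Longrightarrow>
     reval g ys y \<Longrightarrow> reval (Cn g fs) xs y"
| "reval f xs y \<Longrightarrow> reval (Pr f g) (0 # xs) y"
| "reval (Pr f g) (n # xs) r \<Longrightarrow> reval g (n # r # xs) y \<Longrightarrow> reval (Pr f g) (Suc n # xs) y"
| "reval f (n # xs) 0 \<Longrightarrow> (\<forall>i<n. \<exists>k. reval f (i # xs) (Suc k)) \<Longrightarrow> reval (Mn f) xs n"

definition rec_decidable :: "nat set \<Rightarrow> bool" where
  "rec_decidable A \<longleftrightarrow> (\<exists>f. \<forall>k. (k \<in> A \<longrightarrow> reval f [k] 1) \<and> (k \<notin> A \<longrightarrow> reval f [k] 0))"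

fun enc_trm :: "('f \<Rightarrow> nat) \<Rightarrow> 'f trm \<Rightarrow> nat" where
  "enc_trm cf (Var i) = prod_encode (0, i)"
| "enc_trm cf (Fn f ts) = prod_encode (1, prod_encode (cf f, list_encode (map (enc_trm cf) ts)))"

fun enc_fm :: "('f \<Rightarrow> nat) \<Rightarrow> ('p \<Rightarrow> nat) \<Rightarrow> ('f, 'p) fm \<Rightarrow> nat" where
  "enc_fm cf cp FF = prod_encode (0, 0)"
| "enc_fm cf cp (Eq s t) = prod_encode (1, prod_encode (enc_trm cf s, enc_trm cf t))"
| "enc_fm cf cp (Rel p ts) = prod_encode (2, prod_encode (cp p, list_encode (map (enc_trm cf) ts)))"
| "enc_fm cf cp (Imp a b) = prod_encode (3, prod_encode (enc_fm cf cp a, enc_fm cf cp b))"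
| "enc_fm cf cp (Ex i a) = prod_encode (4, prod_encode (i, enc_fm cf cp a))"

definition theory_codes :: "('f \<Rightarrow> nat) \<Rightarrow> ('p \<Rightarrow> nat) \<Rightarrow> ('f \<Rightarrow> nat) \<Rightarrow> ('p \<Rightarrow> nat)
    \<Rightarrow> ('f \<Rightarrow> 'a list \<Rightarrow> 'a) \<Rightarrow> ('p \<Rightarrow> 'a list \<Rightarrow> bool) \<Rightarrow> nat set" where
  "theory_codes cf cp ar par FI PI =
     {enc_fm cf cp \<phi> | \<phi>. wf_fm ar par \<phi> \<and> fv_fm \<phi> = {} \<and> (\<forall>e. sat FI PI e \<phi>)}"

definition undecidable_theory :: "('f \<Rightarrow> nat) \<Rightarrow> ('p \<Rightarrow> nat) \<Rightarrow> ('f \<Rightarrow> 'a list \<Rightarrow> 'a)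
    \<Rightarrow> ('p \<Rightarrow> 'a list \<Rightarrow> bool) \<Rightarrow> bool" where
  "undecidable_theory ar par FI PI \<longleftrightarrow>
     (\<forall>cf cp. inj cf \<longrightarrow> inj cp \<longrightarrow> \<not> rec_decidable (theory_codes cf cp ar par FI PI))"

end

theory Submission
  imports Defs Complex_Main
begin

text \<open>
  If the ring elements \<open>1 + t g\<close>, for \<open>t\<close> in a finite set, are pairwise comaximal nonunits, then a subset
  \<open>B\<close> of that set is recovered from the product \<open>h\<close> of its elements \<open>1 + t g\<close> as the set of \<open>t\<close> for which
  \<open>1 + t g\<close> divides \<open>h\<close>. Applied to \<open>t = s + a + c b\<close>, this codes all relations between two finite
  sets by a few ring elements. Hence the finite members of the family carry coded linear orders. Call a
  member of the family with a coded discrete order with least element (and pairwise comaximal nonunits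
  on all pairs, finite or not) a chain; this is a first-order condition on the parameters. Every recursive
  function has a definable graph on chains: its values at standard positions are correct in every chain,
  and they exist in every sufficiently long one.

  If some chain is infinite, it is itself a model of R, with sum and product defined by recursion and
  completed arbitrarily where they fail to exist. If all chains are finite, the positions in chains,
  identified by coded isomorphisms of initial segments, form the standard model.

  If a recursive function decided the theory, there would be a formula \<open>\<psi>(x)\<close> expressing that the
  sentence ``some chain has an \<open>x\<close>-th element satisfying formula number \<open>x\<close>'' is rejected.
  Quantifying over all chains replaces the parameters. At the code of \<open>\<psi>\<close> this sentence is true iff it is rejected.
\<close>

section \<open>Chains and recursive functions evaluated in them\<close>

lemma comaximal_iff: "comaximal x y \<longleftrightarrow> (\<exists>u v. u * x + v * y = 1)"
proof
  assume "comaximal x y"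
  then have "1 \<in> {u * x + v * y | u v. True}" by (simp add: comaximal_def)
  then show "\<exists>u v. u * x + v * y = 1" by (auto dest: sym)
next
  assume "\<exists>u v. u * x + v * y = 1"
  then obtain u v where uv: "u * x + v * y = 1" by blast
  have "w = (w * u) * x + (w * v) * y" for w
    by (metis uv distrib_left mult.assoc mult.right_neutral)
  then show "comaximal x y" unfolding comaximal_def by blast
qed

lemma comaximal_dvd_multD:
  assumes "comaximal x y" "x dvd h * y"
  shows "x dvd h"
proof -
  obtain u v where uv: "u * x + v * y = 1" using assms(1) comaximal_iff by blast
  have "h = h * u * x + v * (h * y)"
    by (metis uv distrib_left mult.assoc mult.left_commute mult.right_neutral)
  then show ?thesis using assms(2) by (metis dvd_add dvd_mult dvd_triv_right)
qed

text \<open>\<open>h\<close> is the product of the \<open>T p\<close> with \<open>p\<close> in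
  \<open>B\<close>. By comaximality a \<open>T p\<close> with \<open>p\<close> outside
  \<open>B\<close> could be cancelled against each factor in turn and would finally divide 1. Only
  \<open>B\<close> is finite; \<open>U\<close> may be the set of all pairs from an infinite
  chain.\<close>

lemma subset_code:
  fixes T :: "'i \<Rightarrow> 'a::comm_ring_1"
  assumes "\<And>p q. p \<in> U \<Longrightarrow> q \<in> U \<Longrightarrow> p \<noteq> q \<Longrightarrow> comaximal (T p) (T q)"
    and "\<And>p. p \<in> U \<Longrightarrow> \<not> T p dvd 1"
    and "finite B" "B \<subseteq> U"
  shows "\<exists>h. \<forall>p\<in>U. T p dvd h \<longleftrightarrow> p \<in> B"
  using assms(3,4)
proof (induction B rule: finite_induct)
  case empty
  then show ?case using assms(2) by (intro exI[of _ 1]) auto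
next
  case (insert q B)
  then obtain h where h: "\<forall>p\<in>U. T p dvd h \<longleftrightarrow> p \<in> B" by auto
  have "T p dvd h * T q \<longleftrightarrow> p \<in> insert q B" if "p \<in> U" for p
    using h that assms(1)[of p q] insert.prems comaximal_dvd_multD[of "T p" "T q" h]
    by (cases "p = q") auto
  then show ?case by blast
qed

section \<open>Standard positions in a discrete linear order\<close>

definition is_zero :: "'a set \<Rightarrow> ('a \<Rightarrow> 'a \<Rightarrow> bool) \<Rightarrow> 'a \<Rightarrow> bool" where
  "is_zero X L y \<longleftrightarrow> y \<in> X \<and> (\<forall>x\<in>X. L y x)"

definition is_succ :: "'a set \<Rightarrow> ('a \<Rightarrow> 'a \<Rightarrow> bool) \<Rightarrow> 'a \<Rightarrow> 'a \<Rightarrow> bool" where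
  "is_succ X L x y \<longleftrightarrow> x \<in> X \<and> y \<in> X \<and> x \<noteq> y \<and> L x y \<and> (\<forall>z\<in>X. L x z \<longrightarrow> z = x \<or> L y z)"

text \<open>A relation rather than a function, since a short chain has no \<open>n\<close>-th
  element for large \<open>n\<close>.\<close>

primrec num :: "'a set \<Rightarrow> ('a \<Rightarrow> 'a \<Rightarrow> bool) \<Rightarrow> nat \<Rightarrow> 'a \<Rightarrow> bool" where
  "num X L 0 y \<longleftrightarrow> is_zero X L y"
| "num X L (Suc n) y \<longleftrightarrow> (\<exists>x. num X L n x \<and> is_succ X L x y)"

text \<open>A course of values of a primitive recursion is coded by \<open>h\<close>, which stands for the set of pairs
  \<open>(i, v)\<close> with \<open>T i v dvd h\<close>. Each pair has to be justified by its predecessor; no functionality or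
  finiteness is demanded, so a history is extended by multiplying \<open>h\<close> by one more \<open>T i v\<close>.\<close>

primrec computes :: "'a::comm_ring_1 set \<Rightarrow> ('a \<Rightarrow> 'a \<Rightarrow> 'a) \<Rightarrow> ('a \<Rightarrow> 'a \<Rightarrow> bool) \<Rightarrow> recf \<Rightarrow> 'a list \<Rightarrow> 'a \<Rightarrow> bool"
where
  "computes X T L Zr = (\<lambda>xs y. is_zero X L y)"
| "computes X T L Sc = (\<lambda>xs y. xs \<noteq> [] \<and> is_succ X L (hd xs) y)"
| "computes X T L (Pj i) = (\<lambda>xs y. i < length xs \<and> y = xs ! i)"
| "computes X T L (Cn g fs) = (\<lambda>xs y. \<exists>ys. list_all2 (\<lambda>R v. R xs v) (map (computes X T L) fs) ys \<and> computes X T L g ys y)"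
| "computes X T L (Pr f g) = (\<lambda>xs y. xs \<noteq> [] \<and> hd xs \<in> X \<and> y \<in> X \<and>
     (\<exists>h. T (hd xs) y dvd h \<and> (\<forall>i\<in>X. \<forall>v\<in>X. T i v dvd h \<longrightarrow>
        is_zero X L i \<and> computes X T L f (tl xs) v \<or>
        (\<exists>j\<in>X. \<exists>u\<in>X. is_succ X L j i \<and> T j u dvd h \<and> computes X T L g (j # u # tl xs) v))))"
| "computes X T L (Mn f) = (\<lambda>xs y. y \<in> X \<and> (\<exists>z. is_zero X L z \<and> computes X T L f (y # xs) z) \<and>
     (\<forall>i\<in>X. L i y \<longrightarrow> i \<noteq> y \<longrightarrow> (\<exists>k v. is_succ X L k v \<and> computes X T L f (i # xs) v)))"

text \<open>Comaximality and nonunits are part of the notion, because conditions (1) and (2) provide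
  them on finite sets only, while a chain may be infinite. All clauses are first-order, so that
  being a chain is definable in the parameters.\<close>

locale chain =
  fixes X :: "'a::comm_ring_1 set" and T :: "'a \<Rightarrow> 'a \<Rightarrow> 'a" and L :: "'a \<Rightarrow> 'a \<Rightarrow> bool"
  assumes T_comaximal: "\<forall>a\<in>X. \<forall>b\<in>X. \<forall>a'\<in>X. \<forall>b'\<in>X. a \<noteq> a' \<or> b \<noteq> b' \<longrightarrow> comaximal (T a b) (T a' b')"
    and T_nonunit: "\<forall>a\<in>X. \<forall>b\<in>X. \<not> T a b dvd 1"
    and L_antisym: "\<forall>a\<in>X. \<forall>b\<in>X. L a b \<longrightarrow> L b a \<longrightarrow> a = b"
    and L_trans: "\<forall>a\<in>X. \<forall>b\<in>X. \<forall>c\<in>X. L a b \<longrightarrow> L b c \<longrightarrow> L a c"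
    and L_total: "\<forall>a\<in>X. \<forall>b\<in>X. L a b \<or> L b a"
    and zero_ex: "\<exists>z. is_zero X L z"
    and succ_ex: "\<forall>x\<in>X. (\<exists>y\<in>X. L x y \<and> x \<noteq> y) \<longrightarrow> (\<exists>y. is_succ X L x y)"
    and pred_ex: "\<forall>y\<in>X. is_zero X L y \<or> (\<exists>x. is_succ X L x y)"
begin

lemma succ_carrier: "is_succ X L x y \<Longrightarrow> x \<in> X \<and> y \<in> X"
  by (simp add: is_succ_def)

lemma zero_unique: "is_zero X L x \<Longrightarrow> is_zero X L y \<Longrightarrow> x = y"
  using L_antisym unfolding is_zero_def by blast

lemma succ_unique: "is_succ X L x y \<Longrightarrow> is_succ X L x z \<Longrightarrow> y = z"
  using L_antisym unfolding is_succ_def by metis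

lemma succ_inj: "is_succ X L x z \<Longrightarrow> is_succ X L y z \<Longrightarrow> x = y"
  using L_antisym L_total unfolding is_succ_def by metis

lemma zero_not_succ: "is_zero X L y \<Longrightarrow> \<not> is_succ X L x y"
  using L_antisym unfolding is_zero_def is_succ_def by metis

lemma num_carrier: "num X L n x \<Longrightarrow> x \<in> X"
  by (cases n) (auto simp: is_zero_def is_succ_def)

lemma num_unique: "num X L n x \<Longrightarrow> num X L n y \<Longrightarrow> x = y"
  by (induction n arbitrary: x y) (auto dest: zero_unique succ_unique)

lemma num_inj: "num X L n x \<Longrightarrow> num X L m x \<Longrightarrow> n = m"
proof (induction n arbitrary: m x)
  case 0
  then show ?case by (cases m) (auto dest: zero_not_succ)
next
  case (Suc n)
  then show ?case by (cases m) (auto dest: zero_not_succ succ_inj)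
qed

text \<open>Standard positions leave no gaps: what lies above the \<open>n\<close>-th element is
  that element or lies above its successor.\<close>

lemma num_below: "num X L n x \<Longrightarrow> y \<in> X \<Longrightarrow> L x y \<or> (\<exists>i<n. num X L i y)"
proof (induction n arbitrary: x)
  case 0
  then show ?case by (simp add: is_zero_def)
next
  case (Suc n)
  then obtain w where w: "num X L n w" "is_succ X L w x" by auto
  consider "L w y" | i where "i < n" "num X L i y" using Suc.IH[OF w(1) Suc.prems(2)] by blast
  then show ?case
  proof cases
    case 1
    then have "y = w \<or> L x y" using w(2) Suc.prems(2) by (auto simp: is_succ_def)
    then show ?thesis using w(1) by blast
  next
    case 2
    then show ?thesis by (meson less_Suc_eq)
  qed
qed

lemma num_mono: "num X L n x \<Longrightarrow> m \<le> n \<Longrightarrow> \<exists>y. num X L m y"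
proof (induction n arbitrary: x)
  case (Suc n)
  then show ?case by (cases "m = Suc n") auto
qed auto

lemma L_refl: "x \<in> X \<Longrightarrow> L x x"
  using L_total by blast

lemma num_less: "num X L n x \<Longrightarrow> num X L i y \<Longrightarrow> i < n \<Longrightarrow> L y x \<and> y \<noteq> x"
proof (induction n arbitrary: x)
  case (Suc n)
  then obtain w where w: "num X L n w" "is_succ X L w x" by auto
  have "L y w" using Suc.IH[OF w(1)] Suc.prems num_unique[OF w(1)] L_refl num_carrier[OF w(1)]
    by (metis less_SucE)
  then have "L y x" using w L_trans num_carrier[OF Suc.prems(2)]
    unfolding is_succ_def by blast
  then show ?case using Suc.prems num_inj by blast
qed simp

text \<open>If \<open>x\<close> has no standard position, the \<open>n\<close>-th element is below
  and distinct from \<open>x\<close>. Hence it has a successor, which is still below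
  \<open>x\<close>, and the induction continues.\<close>

lemma num_ex_or_unbounded:
  assumes "x \<in> X" shows "(\<exists>n. num X L n x) \<or> (\<forall>n. \<exists>y. num X L n y \<and> L y x)"
proof (rule ccontr)
  assume "\<not> ?thesis"
  then have no: "\<not> num X L n x" and ex: "\<exists>n. \<not> (\<exists>y. num X L n y \<and> L y x)" for n by auto
  have "\<exists>y. num X L n y \<and> L y x" for n
  proof (induction n)
    case 0
    then show ?case using zero_ex assms by (auto simp: is_zero_def)
  next
    case (Suc n)
    then obtain y where y: "num X L n y" "L y x" by blast
    moreover have "y \<noteq> x" using y no by blast
    ultimately obtain z where z: "is_succ X L y z" using succ_ex num_carrier[OF y(1)] assms by blast
    then have "L z x" using y \<open>y \<noteq> x\<close> assms by (auto simp: is_succ_def)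
    then show ?case using y z by auto
  qed
  then show False using ex by blast
qed

text \<open>Without an \<open>N\<close>-th element every element sits at a position less than
  \<open>N\<close>, which leaves at most \<open>N\<close> elements.\<close>

lemma num_long:
  assumes "infinite X \<or> N < card X" shows "\<exists>x. num X L N x"
proof (rule ccontr)
  assume no: "\<not> ?thesis"
  have "X \<subseteq> (\<lambda>i. THE x. num X L i x) ` {..<N}"
  proof
    fix x assume x: "x \<in> X"
    then obtain n where n: "num X L n x" using num_ex_or_unbounded no by blast
    then have "n < N" using num_mono no by (metis not_le_imp_less)
    moreover have "x = (THE x. num X L n x)" using n num_unique by (metis the_equality)
    ultimately show "x \<in> (\<lambda>i. THE x. num X L i x) ` {..<N}" by blast
  qed
  then have "finite X \<and> card X \<le> N"
    by (metis card_image_le card_lessThan card_mono finite_imageI finite_lessThan finite_subset order_trans)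
  then show False using assms by linarith
qed

lemma num_finite:
  assumes "finite X" "x \<in> X" shows "\<exists>n. num X L n x"
proof (rule ccontr)
  assume "\<not> ?thesis"
  then have "\<forall>n. \<exists>y. num X L n y" using num_ex_or_unbounded assms(2) by blast
  then obtain q where q: "\<And>n. num X L n (q n)" by metis
  then have "inj q" by (metis injI num_inj)
  moreover have "range q \<subseteq> X" using q num_carrier by blast
  ultimately show False using assms(1) by (metis finite_subset infinite_UNIV_nat finite_imageD)
qed

section \<open>Recursion equations, soundness and completeness of computation in chains\<close>

lemma T_dvd_mult:
  assumes "a \<in> X" "b \<in> X" "a' \<in> X" "b' \<in> X"
  shows "T a b dvd h * T a' b' \<longleftrightarrow> a = a' \<and> b = b' \<or> T a b dvd h"
  using assms T_comaximal comaximal_dvd_multD[of "T a b" "T a' b'" h] by auto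

lemma computes_Pr_zero:
  assumes "is_zero X L n" "y \<in> X"
  shows "computes X T L (Pr f g) (n # xs) y \<longleftrightarrow> computes X T L f xs y"
proof
  assume "computes X T L (Pr f g) (n # xs) y"
  then show "computes X T L f xs y" using assms zero_not_succ by auto
next
  assume f: "computes X T L f xs y"
  have n: "n \<in> X" using assms by (simp add: is_zero_def)
  \<comment> \<open>The element \<open>T n y\<close> by itself codes the history whose only entry is
    the pair \<open>(n, y)\<close>.\<close>
  have "T i v dvd T n y \<longleftrightarrow> i = n \<and> v = y" if "i \<in> X" "v \<in> X" for i v
    using T_dvd_mult[OF that n assms(2), of 1] T_nonunit that by auto
  then show "computes X T L (Pr f g) (n # xs) y"
    using f n assms by (auto intro!: exI[of _ "T n y"])
qed

text \<open>The recursion equation holds at all neighbouring elements, standard or not. A history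
  for \<open>n\<close> justifies \<open>(n, y)\<close> by an entry at the unique predecessor
  \<open>m\<close> and serves for that entry too; conversely, a history for \<open>m\<close> is
  extended by the factor \<open>T n y\<close>.\<close>

lemma computes_Pr_succ:
  assumes "is_succ X L m n" "y \<in> X"
  shows "computes X T L (Pr f g) (n # xs) y \<longleftrightarrow>
    (\<exists>r\<in>X. computes X T L (Pr f g) (m # xs) r \<and> computes X T L g (m # r # xs) y)"
proof
  assume "computes X T L (Pr f g) (n # xs) y"
  then obtain h where h: "T n y dvd h" "\<forall>i\<in>X. \<forall>v\<in>X. T i v dvd h \<longrightarrow>
        is_zero X L i \<and> computes X T L f xs v \<or>
        (\<exists>j\<in>X. \<exists>u\<in>X. is_succ X L j i \<and> T j u dvd h \<and> computes X T L g (j # u # xs) v)"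
    by auto
  obtain j u where ju: "j \<in> X" "u \<in> X" "is_succ X L j n" "T j u dvd h" "computes X T L g (j # u # xs) y"
    using h assms zero_not_succ succ_carrier by blast
  then have "j = m" using assms succ_inj by blast
  then show "\<exists>r\<in>X. computes X T L (Pr f g) (m # xs) r \<and> computes X T L g (m # r # xs) y"
    using ju h(2) by auto
next
  assume "\<exists>r\<in>X. computes X T L (Pr f g) (m # xs) r \<and> computes X T L g (m # r # xs) y"
  then obtain r h where r: "r \<in> X" "computes X T L g (m # r # xs) y" "T m r dvd h"
    and h: "\<forall>i\<in>X. \<forall>v\<in>X. T i v dvd h \<longrightarrow>
        is_zero X L i \<and> computes X T L f xs v \<or>
        (\<exists>j\<in>X. \<exists>u\<in>X. is_succ X L j i \<and> T j u dvd h \<and> computes X T L g (j # u # xs) v)"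
    by auto
  have mn: "m \<in> X" "n \<in> X" using assms succ_carrier by auto
  have *: "T i v dvd h * T n y \<longleftrightarrow> i = n \<and> v = y \<or> T i v dvd h" if "i \<in> X" "v \<in> X" for i v
    using T_dvd_mult[OF that mn(2) assms(2)] .
  have "\<forall>i\<in>X. \<forall>v\<in>X. T i v dvd h * T n y \<longrightarrow>
        is_zero X L i \<and> computes X T L f xs v \<or>
        (\<exists>j\<in>X. \<exists>u\<in>X. is_succ X L j i \<and> T j u dvd h * T n y \<and> computes X T L g (j # u # xs) v)"
  proof (intro ballI impI)
    fix i v assume iv: "i \<in> X" "v \<in> X" "T i v dvd h * T n y"
    show "is_zero X L i \<and> computes X T L f xs v \<or>
        (\<exists>j\<in>X. \<exists>u\<in>X. is_succ X L j i \<and> T j u dvd h * T n y \<and> computes X T L g (j # u # xs) v)"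
    proof (cases "i = n \<and> v = y")
      case True
      moreover have "T m r dvd h * T n y" using r by simp
      ultimately show ?thesis using r mn assms(1) by blast
    next
      case False
      then have "T i v dvd h" using iv * by blast
      then show ?thesis using h iv by (meson dvd_mult2)
    qed
  qed
  moreover have "T n y dvd h * T n y" by simp
  ultimately show "computes X T L (Pr f g) (n # xs) y" using mn assms(2)
    unfolding computes.simps list.sel by blast
qed

text \<open>No assumption on the length is made: a chain can lack a value but not produce a wrong or
  nonstandard one. For \<open>Pr\<close> the value is traced back along unique predecessors. For
  \<open>Mn\<close> the candidate \<open>y\<close> is not known to be standard and has to be
  compared with \<open>n\<close> through the order.\<close>

lemma computes_sound:
  "reval f ns m \<Longrightarrow> list_all2 (num X L) ns xs \<Longrightarrow> computes X T L f xs y \<Longrightarrow> num X L m y"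
proof (induction arbitrary: xs y rule: reval.induct)
  case (2 n ns)
  then show ?case by (cases xs) auto
next
  case (3 i ns)
  then show ?case by (auto simp: list_all2_conv_all_nth)
next
  case (4 ms fs ns g m)
  then obtain ys where ys: "list_all2 (\<lambda>R v. R xs v) (map (computes X T L) fs) ys" "computes X T L g ys y" by auto
  have "list_all2 (num X L) ms ys"
    using ys(1) 4 by (auto simp: list_all2_conv_all_nth)
  then show ?case using 4 ys by blast
next
  case (5 f ns m g)
  then obtain n zs where xs: "xs = n # zs" "is_zero X L n" "list_all2 (num X L) ns zs"
    by (cases xs) auto
  have "y \<in> X" using 5(4) by auto
  then show ?case using 5 xs computes_Pr_zero by blast
next
  case (6 f g n ns r m)
  then obtain a zs where xs: "xs = a # zs" "num X L (Suc n) a" "list_all2 (num X L) ns zs"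
    by (cases xs) auto
  then obtain b where b: "num X L n b" "is_succ X L b a" by auto
  have y: "y \<in> X" using 6 by auto
  then obtain v where v: "computes X T L (Pr f g) (b # zs) v" "computes X T L g (b # v # zs) y"
    using computes_Pr_succ[OF b(2) y] 6 xs by blast
  have "num X L r v" using 6(3)[of "b # zs"] b xs v by (auto simp del: computes.simps)
  then show ?case using 6(4)[of "b # v # zs"] b xs v by (auto simp del: computes.simps)
next
  case (7 f n ns)
  have y: "y \<in> X" using 7 by auto
  obtain z where z: "is_zero X L z" "computes X T L f (y # xs) z" using 7 by auto
  \<comment> \<open>At a position below \<open>n\<close> the value of \<open>f\<close> is a
    successor, whereas at \<open>y\<close> it is the least element.\<close>
  have no: "\<not> num X L i y" if i: "i < n" for i
  proof
    assume i': "num X L i y"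
    obtain k where k: "\<forall>xs y. list_all2 (num X L) (i # ns) xs \<longrightarrow> computes X T L f xs y \<longrightarrow> num X L (Suc k) y"
      using 7 i by blast
    have "num X L (Suc k) z" using k i' 7 z by (auto simp del: num.simps)
    moreover have "num X L 0 z" using z by simp
    ultimately show False using num_inj by blast
  qed
  show ?case
  proof (cases "\<exists>x. num X L n x")
    case True
    then obtain x where x: "num X L n x" ..
    then have Lxy: "L x y" using num_below y no by blast
    show ?thesis
    proof (rule ccontr)
      assume "\<not> ?thesis"
      then have "x \<noteq> y" using x by blast
      then obtain k v where kv: "is_succ X L k v" "computes X T L f (x # xs) v"
        using 7 Lxy num_carrier[OF x] by auto
      have "num X L 0 v" using 7(2)[of "x # xs"] x 7 kv by (auto simp del: num.simps)
      then show False using zero_not_succ kv by auto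
    qed
  next
    case False
    \<comment> \<open>A chain without an \<open>n\<close>-th element has only positions below
      \<open>n\<close>, and these are excluded.\<close>
    then obtain i where i: "num X L i y" using num_ex_or_unbounded y by blast
    then have "i < n" using no False num_mono by (metis not_less)
    then show ?thesis using i no by blast
  qed
qed auto

end

text \<open>An evaluation has finitely many intermediate values, so a chain with an
  \<open>N\<close>-th element for some large \<open>N\<close> has room for all of them. The filter
  merges the bounds of the subevaluations, and it stands outside the quantifier over chains, so that
  one bound serves them all.\<close>

lemma computes_complete:
  "reval f ns m \<Longrightarrow> \<forall>\<^sub>F N in sequentially. \<forall>(X::'a::comm_ring_1 set) T L. chain X T L \<longrightarrow> (\<exists>x. num X L N x) \<longrightarrow>
     (\<forall>xs. list_all2 (num X L) ns xs \<longrightarrow> (\<exists>y. num X L m y \<and> computes X T L f xs y))"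
proof (induction rule: reval.induct)
  case (1 xs)
  then show ?case by (intro always_eventually) (auto simp: chain.zero_ex)
next
  case (2 n ns)
  show ?case
  proof (rule eventually_sequentiallyI[of "Suc n"], intro allI impI)
    fix N :: nat and X :: "'a set" and T L xs
    assume a: "Suc n \<le> N" "chain X T L" "\<exists>x. num X L N x" "list_all2 (num X L) (n # ns) xs"
    then obtain x zs where xs: "xs = x # zs" "num X L n x" by (cases xs) auto
    obtain y where y: "num X L (Suc n) y" using a chain.num_mono by metis
    then have "is_succ X L x y" using xs chain.num_unique[OF a(2)] by auto
    then show "\<exists>y. num X L (Suc n) y \<and> computes X T L Sc xs y" using y xs by auto
  qed
next
  case (3 i xs)
  then show ?case by (intro always_eventually) (auto simp: list_all2_conv_all_nth)
next
  case (4 ms fs ns g m)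
  have "\<forall>\<^sub>F N in sequentially. \<forall>i\<in>{..<length fs}. \<forall>(X::'a set) T L. chain X T L \<longrightarrow> (\<exists>x. num X L N x) \<longrightarrow>
     (\<forall>xs. list_all2 (num X L) ns xs \<longrightarrow> (\<exists>y. num X L (ms!i) y \<and> computes X T L (fs!i) xs y))"
    using 4 by (intro eventually_ball_finite) auto
  then show ?case using 4(4)
  proof eventually_elim
    case (elim N)
    show ?case
    proof (intro allI impI)
      fix X :: "'a set" and T L xs
      assume a: "chain X T L" "\<exists>x. num X L N x" "list_all2 (num X L) ns xs"
      then have "\<forall>i<length fs. \<exists>y. num X L (ms!i) y \<and> computes X T L (fs!i) xs y" using elim(1) by blast
      then obtain q where q: "\<forall>i<length fs. num X L (ms!i) (q i) \<and> computes X T L (fs!i) xs (q i)" by metis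
      let ?ys = "map q [0..<length fs]"
      have "list_all2 (num X L) ms ?ys" using q 4(1) by (auto simp: list_all2_conv_all_nth)
      moreover have "list_all2 (\<lambda>R v. R xs v) (map (computes X T L) fs) ?ys"
        using q by (auto simp: list_all2_conv_all_nth)
      ultimately show "\<exists>y. num X L m y \<and> computes X T L (Cn g fs) xs y"
        using elim(2) a unfolding computes.simps by blast
    qed
  qed
next
  case (5 f ns m g)
  from 5(2) show ?case
  proof eventually_elim
    case (elim N)
    show ?case
    proof (intro allI impI)
      fix X :: "'a set" and T L xs
      assume a: "chain X T L" "\<exists>x. num X L N x" "list_all2 (num X L) (0 # ns) xs"
      then obtain n zs where xs: "xs = n # zs" "is_zero X L n" "list_all2 (num X L) ns zs"
        by (cases xs) auto
      obtain y where y: "num X L m y" "computes X T L f zs y" using elim a xs by blast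
      then show "\<exists>y. num X L m y \<and> computes X T L (Pr f g) xs y"
        using chain.computes_Pr_zero[OF a(1) xs(2)] chain.num_carrier[OF a(1)] xs by blast
    qed
  qed
next
  case (6 f g n ns r m)
  from 6(3,4) show ?case
  proof eventually_elim
    case (elim N)
    show ?case
    proof (intro allI impI)
      fix X :: "'a set" and T L xs
      assume a: "chain X T L" "\<exists>x. num X L N x" "list_all2 (num X L) (Suc n # ns) xs"
      then obtain x zs where xs: "xs = x # zs" "num X L (Suc n) x" "list_all2 (num X L) ns zs"
        by (cases xs) auto
      then obtain b where b: "num X L n b" "is_succ X L b x" by auto
      have "list_all2 (num X L) (n # ns) (b # zs)" using b xs by simp
      then obtain v where v: "num X L r v" "computes X T L (Pr f g) (b # zs) v" using elim(1) a by blast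
      have "list_all2 (num X L) (n # r # ns) (b # v # zs)" using b xs v by simp
      then obtain y where y: "num X L m y" "computes X T L g (b # v # zs) y" using elim(2) a by blast
      then show "\<exists>y. num X L m y \<and> computes X T L (Pr f g) xs y"
        using chain.computes_Pr_succ[OF a(1) b(2)] chain.num_carrier[OF a(1)] xs v by blast
    qed
  qed
next
  case (7 f n ns)
  have "\<forall>\<^sub>F N in sequentially. \<forall>i\<in>{..<n}. \<exists>k. \<forall>(X::'a set) T L. chain X T L \<longrightarrow> (\<exists>x. num X L N x) \<longrightarrow>
     (\<forall>xs. list_all2 (num X L) (i # ns) xs \<longrightarrow> (\<exists>y. num X L (Suc k) y \<and> computes X T L f xs y))"
  proof (intro eventually_ball_finite ballI)
    fix i assume "i \<in> {..<n}"
    then obtain k where k: "\<forall>\<^sub>F N in sequentially. \<forall>(X::'a set) T L. chain X T L \<longrightarrow> (\<exists>x. num X L N x) \<longrightarrow>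
     (\<forall>xs. list_all2 (num X L) (i # ns) xs \<longrightarrow> (\<exists>y. num X L (Suc k) y \<and> computes X T L f xs y))"
      using 7(3) by auto
    then show "\<forall>\<^sub>F N in sequentially. \<exists>k. \<forall>(X::'a set) T L. chain X T L \<longrightarrow> (\<exists>x. num X L N x) \<longrightarrow>
     (\<forall>xs. list_all2 (num X L) (i # ns) xs \<longrightarrow> (\<exists>y. num X L (Suc k) y \<and> computes X T L f xs y))"
      by eventually_elim blast
  qed simp
  then show ?case using 7(2) eventually_ge_at_top[of n]
  proof eventually_elim
    case (elim N)
    show ?case
    proof (intro allI impI)
      fix X :: "'a set" and T L xs
      assume a: "chain X T L" "\<exists>x. num X L N x" "list_all2 (num X L) ns xs"
      obtain y where y: "num X L n y" using a elim(3) chain.num_mono by metis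
      have "list_all2 (num X L) (n # ns) (y # xs)" using y a by simp
      then obtain z where z: "num X L 0 z" "computes X T L f (y # xs) z" using elim(2) a by blast
      \<comment> \<open>Elements below the \<open>n\<close>-th one are at standard positions, so the
        hypothesis about smaller arguments reaches all of them.\<close>
      have "\<exists>k v. is_succ X L k v \<and> computes X T L f (i # xs) v" if i: "i \<in> X" "L i y" "i \<noteq> y" for i
      proof -
        have "\<not> L y i" using i chain.L_antisym[OF a(1)] chain.num_carrier[OF a(1) y] by blast
        then obtain j where j: "j < n" "num X L j i"
          using chain.num_below[OF a(1) y i(1)] by blast
        then have "list_all2 (num X L) (j # ns) (i # xs)" using a by simp
        then obtain k v where "num X L (Suc k) v" "computes X T L f (i # xs) v"
          using elim(1) a j by (metis lessThan_iff)
        then show ?thesis by auto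
      qed
      then have "computes X T L (Mn f) xs y"
        using z chain.num_carrier[OF a(1) y] by auto
      then show "\<exists>y. num X L n y \<and> computes X T L (Mn f) xs y" using y by blast
    qed
  qed
qed

section \<open>Coding finite relations by divisibility\<close>

text \<open>For \<open>b \<noteq> b'\<close> the equation \<open>c * (b - b') = a' - a\<close> has
  at most one solution \<open>c\<close> in a domain. So all but finitely many \<open>c\<close> make
  \<open>a + c * b\<close> injective on pairs, and condition (2) is applied to the shifted values
  \<open>s + a + c * b\<close>.\<close>

lemma pair_code:
  fixes A B :: "'a::idom set"
  assumes "infinite (UNIV :: 'a set)" "cond1 TYPE('a)" "cond2 TYPE('a)" "finite A" "finite B"
  obtains c s g where
    "\<forall>a\<in>A. \<forall>b\<in>B. \<forall>a'\<in>A. \<forall>b'\<in>B. a \<noteq> a' \<or> b \<noteq> b' \<longrightarrow>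
       comaximal (1 + (s + a + c * b) * g) (1 + (s + a' + c * b') * g)"
    "\<forall>a\<in>A. \<forall>b\<in>B. \<not> (1 + (s + a + c * b) * g) dvd 1"
proof -
  let ?bad = "\<Union>a\<in>A. \<Union>a'\<in>A. \<Union>b\<in>B. \<Union>b'\<in>B. {c. b \<noteq> b' \<and> c * (b - b') = a' - a}"
  have "finite {c. b \<noteq> b' \<and> c * (b - b') = a' - a}" for a a' b b' :: 'a
  proof (cases "\<exists>c. b \<noteq> b' \<and> c * (b - b') = a' - a")
    case True
    then obtain c where "b \<noteq> b'" "c * (b - b') = a' - a" by blast
    then have "{c. b \<noteq> b' \<and> c * (b - b') = a' - a} \<subseteq> {c}"
      by auto (metis eq_iff_diff_eq_0 mult_cancel_right)
    then show ?thesis using finite_subset by blast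
  next
    case False
    then have "{c. b \<noteq> b' \<and> c * (b - b') = a' - a} = {}" by blast
    then show ?thesis by (simp only: finite.emptyI)
  qed
  then have "finite ?bad" using assms(4,5) by (intro finite_UN_I)
  then obtain c where c: "c \<notin> ?bad" using ex_new_if_finite[OF assms(1)] by blast
  have inj: "a = a' \<and> b = b'"
    if h: "a \<in> A" "a' \<in> A" "b \<in> B" "b' \<in> B" "a + c * b = a' + c * b'" for a a' b b'
  proof -
    have "c * (b - b') = a' - a" using h(5) by (simp add: algebra_simps)
    then have "b = b'" using c h by blast
    then show ?thesis using h(5) by simp
  qed
  \<comment> \<open>The shift \<open>s\<close> keeps 0 out of the set to which condition (2) is
    applied.\<close>
  obtain s where s: "s \<notin> (\<lambda>(a, b). - (a + c * b)) ` (A \<times> B)"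
    using ex_new_if_finite[OF assms(1), of "(\<lambda>(a, b). - (a + c * b)) ` (A \<times> B)"] assms(4,5) by blast
  let ?A = "(\<lambda>(a, b). s + a + c * b) ` (A \<times> B)"
  have nz: "0 \<notin> ?A"
  proof
    assume "0 \<in> ?A"
    then obtain a b where "a \<in> A" "b \<in> B" "s + a + c * b = 0" by auto
    then have "s = - (a + c * b)" by (metis eq_neg_iff_add_eq_0 add.assoc)
    then show False using s \<open>a \<in> A\<close> \<open>b \<in> B\<close> by auto
  qed
  \<comment> \<open>Condition (2) is applied with \<open>x\<close> as its nonzero nonunit
    \<open>a\<close>; condition (1) supplies it.\<close>
  obtain x :: 'a where x: "x \<noteq> 0" "\<not> x dvd 1" using assms(2) unfolding cond1_def by blast
  have "finite ?A" using assms(4,5) by blast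
  then obtain g where g: "\<forall>ai\<in>?A. 1 + ai * g \<noteq> 0 \<and> \<not> (1 + ai * g) dvd 1"
    "\<forall>ai\<in>?A. \<forall>aj\<in>?A. ai \<noteq> aj \<longrightarrow> comaximal (1 + ai * g) (1 + aj * g)"
    using assms(3) nz x unfolding cond2_def by meson
  have mem: "s + a + c * b \<in> ?A" if "a \<in> A" "b \<in> B" for a b
    using that by auto
  show ?thesis
  proof (rule that)
    show "\<forall>a\<in>A. \<forall>b\<in>B. \<forall>a'\<in>A. \<forall>b'\<in>B. a \<noteq> a' \<or> b \<noteq> b' \<longrightarrow>
       comaximal (1 + (s + a + c * b) * g) (1 + (s + a' + c * b') * g)"
    proof (intro ballI impI)
      fix a b a' b' assume h: "a \<in> A" "b \<in> B" "a' \<in> A" "b' \<in> B" "a \<noteq> a' \<or> b \<noteq> b'"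
      then have "s + a + c * b \<noteq> s + a' + c * b'" using inj[of a a' b b'] by (auto simp: add.assoc)
      then show "comaximal (1 + (s + a + c * b) * g) (1 + (s + a' + c * b') * g)"
        using g(2) mem h by blast
    qed
    show "\<forall>a\<in>A. \<forall>b\<in>B. \<not> (1 + (s + a + c * b) * g) dvd 1" using g(1) mem by blast
  qed
qed

text \<open>Any enumeration \<open>f\<close> of \<open>X\<close> orders it, and the finite set of
  pairs with \<open>f a \<le> f b\<close> is coded by \<open>h\<close>.\<close>

lemma chain_ex:
  fixes X :: "'a::idom set"
  assumes "infinite (UNIV :: 'a set)" "cond1 TYPE('a)" "cond2 TYPE('a)" "finite X" "X \<noteq> {}"
  obtains c s g h where
    "chain X (\<lambda>a b. 1 + (s + a + c * b) * g) (\<lambda>a b. (1 + (s + a + c * b) * g) dvd h)"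
proof -
  obtain c s g where
    T: "\<forall>a\<in>X. \<forall>b\<in>X. \<forall>a'\<in>X. \<forall>b'\<in>X. a \<noteq> a' \<or> b \<noteq> b' \<longrightarrow>
       comaximal (1 + (s + a + c * b) * g) (1 + (s + a' + c * b') * g)"
    "\<forall>a\<in>X. \<forall>b\<in>X. \<not> (1 + (s + a + c * b) * g) dvd 1"
    by (rule pair_code[OF assms(1-4) assms(4)])
  obtain f where f: "bij_betw f X {0..<card X}" using ex_bij_betw_finite_nat[OF assms(4)] by blast
  let ?T = "\<lambda>(a, b). 1 + (s + a + c * b) * g"
  have "\<exists>h. \<forall>p\<in>X \<times> X. ?T p dvd h \<longleftrightarrow> p \<in> {(a, b) \<in> X \<times> X. f a \<le> f b}"
    by (rule subset_code) (use T assms(4) in \<open>auto intro: finite_subset[of _ "X \<times> X"]\<close>)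
  then obtain h where h: "\<And>a b. a \<in> X \<Longrightarrow> b \<in> X \<Longrightarrow> (1 + (s + a + c * b) * g) dvd h \<longleftrightarrow> f a \<le> f b"
    by force
  have inj: "f a = f b \<longleftrightarrow> a = b" if "a \<in> X" "b \<in> X" for a b
    using f that by (auto simp: bij_betw_def inj_on_def)
  have lt: "f a < card X" if "a \<in> X" for a using f that by (auto simp: bij_betw_def)
  have surj: "\<exists>a\<in>X. f a = i" if "i < card X" for i
  proof -
    have "i \<in> f ` X" using f that by (simp add: bij_betw_def)
    then show ?thesis by blast
  qed
  have succ: "is_succ X (\<lambda>a b. (1 + (s + a + c * b) * g) dvd h) x y"
    if "x \<in> X" "y \<in> X" "f y = Suc (f x)" for x y
    using that inj[of _ x]
    by (auto simp: is_succ_def h) (metis Suc_leI le_neq_implies_less)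
  have "card X > 0" using assms by (simp add: card_gt_0_iff)
  then obtain z where z: "z \<in> X" "f z = 0" using surj by blast
  have "chain X (\<lambda>a b. 1 + (s + a + c * b) * g) (\<lambda>a b. (1 + (s + a + c * b) * g) dvd h)"
  proof
    show "\<exists>z. is_zero X (\<lambda>a b. (1 + (s + a + c * b) * g) dvd h) z"
      using z h by (auto simp: is_zero_def)
    show "\<forall>x\<in>X. (\<exists>y\<in>X. (1 + (s + x + c * y) * g) dvd h \<and> x \<noteq> y) \<longrightarrow>
      (\<exists>y. is_succ X (\<lambda>a b. (1 + (s + a + c * b) * g) dvd h) x y)"
    proof (intro ballI impI)
      fix x assume x: "x \<in> X" "\<exists>y\<in>X. (1 + (s + x + c * y) * g) dvd h \<and> x \<noteq> y"
      then obtain y where "y \<in> X" "f x < f y" using h inj by (metis le_neq_implies_less)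
      then obtain w where "w \<in> X" "f w = Suc (f x)" using surj lt by (meson Suc_leI le_less_trans)
      then show "\<exists>y. is_succ X (\<lambda>a b. (1 + (s + a + c * b) * g) dvd h) x y" using succ x by blast
    qed
    show "\<forall>y\<in>X. is_zero X (\<lambda>a b. (1 + (s + a + c * b) * g) dvd h) y \<or>
      (\<exists>x. is_succ X (\<lambda>a b. (1 + (s + a + c * b) * g) dvd h) x y)"
    proof
      fix y assume y: "y \<in> X"
      show "is_zero X (\<lambda>a b. (1 + (s + a + c * b) * g) dvd h) y \<or>
      (\<exists>x. is_succ X (\<lambda>a b. (1 + (s + a + c * b) * g) dvd h) x y)"
      proof (cases "f y")
        case 0
        then show ?thesis using y h by (auto simp: is_zero_def)
      next
        case (Suc n)
        then obtain x where "x \<in> X" "f x = n" using surj lt[OF y] by (metis Suc_lessD)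
        then show ?thesis using succ[of x y] y Suc by blast
      qed
    qed
    show "\<forall>a\<in>X. \<forall>b\<in>X. (1 + (s + a + c * b) * g) dvd h \<longrightarrow> (1 + (s + b + c * a) * g) dvd h \<longrightarrow> a = b"
      using inj by (auto simp: h intro: order_antisym)
    show "\<forall>a\<in>X. \<forall>b\<in>X. \<forall>d\<in>X. (1 + (s + a + c * b) * g) dvd h \<longrightarrow> (1 + (s + b + c * d) * g) dvd h \<longrightarrow>
      (1 + (s + a + c * d) * g) dvd h"
      by (auto simp: h)
    show "\<forall>a\<in>X. \<forall>b\<in>X. (1 + (s + a + c * b) * g) dvd h \<or> (1 + (s + b + c * a) * g) dvd h"
      by (auto simp: h)
  qed (fact T)+
  then show ?thesis by (rule that)
qed

section \<open>Definable predicates\<close>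

lemma teval_cong: "(\<And>i. i \<in> fv_trm t \<Longrightarrow> e i = e' i) \<Longrightarrow> teval FI e t = teval FI e' t"
proof (induction t)
  case (Fn f ts)
  then have "map (teval FI e) ts = map (teval FI e') ts" by fastforce
  then show ?case by (simp only: teval.simps)
qed simp

lemma sat_cong: "(\<And>i. i \<in> fv_fm \<phi> \<Longrightarrow> e i = e' i) \<Longrightarrow> sat FI PI e \<phi> = sat FI PI e' \<phi>"
proof (induction \<phi> arbitrary: e e')
  case (Eq s t)
  then show ?case using teval_cong[of s e e'] teval_cong[of t e e'] by simp
next
  case (Rel p ts)
  then have "map (teval FI e) ts = map (teval FI e') ts"
    by (intro map_cong refl teval_cong) auto
  then show ?case by (simp only: sat.simps)
next
  case (Imp \<phi>1 \<phi>2)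
  have "sat FI PI e \<phi>1 = sat FI PI e' \<phi>1" "sat FI PI e \<phi>2 = sat FI PI e' \<phi>2"
    using Imp.IH[of e e'] Imp.prems by simp_all
  then show ?case by simp
next
  case (Ex i \<phi>)
  have "sat FI PI (e(i := x)) \<phi> = sat FI PI (e'(i := x)) \<phi>" for x
    using Ex.prems by (intro Ex.IH) auto
  then show ?case by simp
qed simp

lemma finite_fv_trm: "finite (fv_trm t)"
  by (induction t) auto

lemma finite_fv_fm: "finite (fv_fm \<phi>)"
  by (induction \<phi>) (auto simp: finite_fv_trm)

fun ren_trm :: "(nat \<Rightarrow> nat) \<Rightarrow> 'f trm \<Rightarrow> 'f trm" where
  "ren_trm \<sigma> (Var i) = Var (\<sigma> i)"
| "ren_trm \<sigma> (Fn f ts) = Fn f (map (ren_trm \<sigma>) ts)"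

lemma wf_ren_trm: "wf_trm ar t \<Longrightarrow> wf_trm ar (ren_trm \<sigma> t)"
  by (induction t) auto

lemma teval_ren_trm: "teval FI e (ren_trm \<sigma> t) = teval FI (\<lambda>i. e (\<sigma> i)) t"
proof (induction t)
  case (Fn f ts)
  then have "map (teval FI e \<circ> ren_trm \<sigma>) ts = map (teval FI (\<lambda>i. e (\<sigma> i))) ts" by simp
  then show ?case by (simp only: ren_trm.simps teval.simps map_map)
qed simp

text \<open>The map \<open>\<sigma>\<close> need not be injective, so a bound variable is replaced
  by one outside the image of the free variables; this prevents capture.\<close>

lemma sat_rename:
  "wf_fm ar par \<phi> \<Longrightarrow> \<exists>\<phi>'. wf_fm ar par \<phi>' \<and> (\<forall>e. sat FI PI e \<phi>' \<longleftrightarrow> sat FI PI (\<lambda>i. e (\<sigma> i)) \<phi>)"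
proof (induction \<phi> arbitrary: \<sigma>)
  case FF
  show ?case by (intro exI[of _ FF]) simp
next
  case (Eq s t)
  then show ?case by (intro exI[of _ "Eq (ren_trm \<sigma> s) (ren_trm \<sigma> t)"]) (simp add: wf_ren_trm teval_ren_trm)
next
  case (Rel p ts)
  have "teval FI e \<circ> ren_trm \<sigma> = teval FI (\<lambda>i. e (\<sigma> i))" for e
    by (rule ext) (simp add: teval_ren_trm)
  then show ?case using Rel by (intro exI[of _ "Rel p (map (ren_trm \<sigma>) ts)"]) (auto simp: wf_ren_trm)
next
  case (Imp \<phi>1 \<phi>2)
  from Imp.IH[of \<sigma>] Imp.prems obtain \<phi>1' \<phi>2' where
    "wf_fm ar par \<phi>1'" "wf_fm ar par \<phi>2'"
    "\<forall>e. sat FI PI e \<phi>1' \<longleftrightarrow> sat FI PI (\<lambda>i. e (\<sigma> i)) \<phi>1"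
    "\<forall>e. sat FI PI e \<phi>2' \<longleftrightarrow> sat FI PI (\<lambda>i. e (\<sigma> i)) \<phi>2" by auto
  then show ?case by (intro exI[of _ "Imp \<phi>1' \<phi>2'"]) simp
next
  case (Ex i \<phi>)
  have "finite (\<sigma> ` fv_fm \<phi>)" by (simp add: finite_fv_fm)
  then obtain j where j: "j \<notin> \<sigma> ` fv_fm \<phi>"
    using ex_new_if_finite[OF infinite_UNIV_nat] by blast
  obtain \<phi>' where \<phi>': "wf_fm ar par \<phi>'"
    "\<forall>e. sat FI PI e \<phi>' \<longleftrightarrow> sat FI PI (\<lambda>k. e ((\<sigma>(i := j)) k)) \<phi>"
    using Ex.IH[of "\<sigma>(i := j)"] Ex.prems by auto
  have "sat FI PI (\<lambda>k. (e(j := x)) ((\<sigma>(i := j)) k)) \<phi> = sat FI PI ((\<lambda>k. e (\<sigma> k))(i := x)) \<phi>" for e x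
    using j by (intro sat_cong) auto
  then show ?case using \<phi>' by (intro exI[of _ "Ex j \<phi>'"]) simp
qed

abbreviation Neg :: "('f, 'p) fm \<Rightarrow> ('f, 'p) fm" where
  "Neg \<phi> \<equiv> Imp \<phi> FF"

abbreviation And :: "('f, 'p) fm \<Rightarrow> ('f, 'p) fm \<Rightarrow> ('f, 'p) fm" where
  "And \<phi> \<psi> \<equiv> Neg (Imp \<phi> (Neg \<psi>))"

lemma sat_foldr_Ex:
  "sat FI PI e (foldr Ex vs \<phi>) \<longleftrightarrow> (\<exists>e'. (\<forall>i. i \<notin> set vs \<longrightarrow> e' i = e i) \<and> sat FI PI e' \<phi>)"
proof (induction vs arbitrary: e)
  case Nil
  have "e' = e" if "\<forall>i. e' i = e i" for e' using that by blast
  then show ?case by auto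
next
  case (Cons v vs)
  have "(\<exists>x e'. (\<forall>i. i \<notin> set vs \<longrightarrow> e' i = (e(v := x)) i) \<and> sat FI PI e' \<phi>) \<longleftrightarrow>
    (\<exists>e'. (\<forall>i. i \<notin> set (v # vs) \<longrightarrow> e' i = e i) \<and> sat FI PI e' \<phi>)" (is "?l \<longleftrightarrow> ?r")
  proof
    assume ?l
    then obtain x e' where e': "\<forall>i. i \<notin> set vs \<longrightarrow> e' i = (e(v := x)) i" "sat FI PI e' \<phi>" by blast
    have "\<forall>i. i \<notin> set (v # vs) \<longrightarrow> e' i = e i" using e'(1) by auto
    then show ?r using e'(2) by blast
  next
    assume ?r
    then obtain e' where e': "\<forall>i. i \<notin> set (v # vs) \<longrightarrow> e' i = e i" "sat FI PI e' \<phi>" by blast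
    have "\<forall>i. i \<notin> set vs \<longrightarrow> e' i = (e(v := e' v)) i" using e'(1) by auto
    then show ?l using e'(2) by blast
  qed
  then show ?case using Cons.IH by simp
qed

lemma fv_foldr_Ex: "fv_fm (foldr Ex vs \<phi>) = fv_fm \<phi> - set vs"
  by (induction vs) auto

lemma wf_foldr_Ex: "wf_fm ar par (foldr Ex vs \<phi>) = wf_fm ar par \<phi>"
  by (induction vs) auto

locale ring_structure =
  fixes ar :: "'f \<Rightarrow> nat" and par :: "'p \<Rightarrow> nat"
    and FI :: "'f \<Rightarrow> 'a::comm_ring_1 list \<Rightarrow> 'a" and PI :: "'p \<Rightarrow> 'a list \<Rightarrow> bool"
  assumes expands: "expands_ring ar FI"
begin

text \<open>Definability is a property of predicates on environments, so that formulas are assembled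
  by introduction rules instead of being written out. Parameters appear as entries of the
  environment.\<close>

definition dfn :: "((nat \<Rightarrow> 'a) \<Rightarrow> bool) \<Rightarrow> bool" where
  "dfn P \<longleftrightarrow> (\<exists>\<phi>. wf_fm ar par \<phi> \<and> (\<forall>e. sat FI PI e \<phi> \<longleftrightarrow> P e))"

definition tdfn :: "((nat \<Rightarrow> 'a) \<Rightarrow> 'a) \<Rightarrow> bool" where
  "tdfn u \<longleftrightarrow> (\<exists>t. wf_trm ar t \<and> (\<forall>e. teval FI e t = u e))"

lemma tdfn_var: "tdfn (\<lambda>e. e i)"
  unfolding tdfn_def by (intro exI[of _ "Var i"]) simp

lemma tdfn_one: "tdfn (\<lambda>e. 1)"
proof -
  obtain f where "ar f = 0" "FI f [] = 1" using expands unfolding expands_ring_def by blast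
  then show ?thesis unfolding tdfn_def by (intro exI[of _ "Fn f []"]) simp
qed

lemma tdfn_add: assumes "tdfn u" "tdfn v" shows "tdfn (\<lambda>e. u e + v e)"
proof -
  obtain f where "ar f = 2" "\<forall>x y. FI f [x, y] = x + y" using expands unfolding expands_ring_def by blast
  moreover obtain s t where "wf_trm ar s" "\<forall>e. teval FI e s = u e" "wf_trm ar t" "\<forall>e. teval FI e t = v e"
    using assms unfolding tdfn_def by blast
  ultimately show ?thesis unfolding tdfn_def by (intro exI[of _ "Fn f [s, t]"]) simp
qed

lemma tdfn_mult: assumes "tdfn u" "tdfn v" shows "tdfn (\<lambda>e. u e * v e)"
proof -
  obtain f where "ar f = 2" "\<forall>x y. FI f [x, y] = x * y" using expands unfolding expands_ring_def by blast
  moreover obtain s t where "wf_trm ar s" "\<forall>e. teval FI e s = u e" "wf_trm ar t" "\<forall>e. teval FI e t = v e"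
    using assms unfolding tdfn_def by blast
  ultimately show ?thesis unfolding tdfn_def by (intro exI[of _ "Fn f [s, t]"]) simp
qed

lemma dfn_False: "dfn (\<lambda>e. False)"
  unfolding dfn_def by (intro exI[of _ FF]) simp

lemma dfn_imp: assumes "dfn P" "dfn Q" shows "dfn (\<lambda>e. P e \<longrightarrow> Q e)"
proof -
  obtain \<phi> \<psi> where "wf_fm ar par \<phi>" "\<forall>e. sat FI PI e \<phi> \<longleftrightarrow> P e"
    "wf_fm ar par \<psi>" "\<forall>e. sat FI PI e \<psi> \<longleftrightarrow> Q e" using assms unfolding dfn_def by blast
  then show ?thesis unfolding dfn_def by (intro exI[of _ "Imp \<phi> \<psi>"]) simp
qed

lemma dfn_not: "dfn P \<Longrightarrow> dfn (\<lambda>e. \<not> P e)"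
  using dfn_imp[OF _ dfn_False] by simp

lemma dfn_True: "dfn (\<lambda>e. True)"
  using dfn_not[OF dfn_False] by simp

lemma dfn_conj: assumes "dfn P" "dfn Q" shows "dfn (\<lambda>e. P e \<and> Q e)"
  using dfn_not[OF dfn_imp[OF assms(1) dfn_not[OF assms(2)]]] by simp

lemma dfn_disj: assumes "dfn P" "dfn Q" shows "dfn (\<lambda>e. P e \<or> Q e)"
  using dfn_imp[OF dfn_not[OF assms(1)] assms(2)] by (simp add: disj_imp)

lemma dfn_eq: assumes "tdfn u" "tdfn v" shows "dfn (\<lambda>e. u e = v e)"
proof -
  obtain s t where "wf_trm ar s" "\<forall>e. teval FI e s = u e" "wf_trm ar t" "\<forall>e. teval FI e t = v e"
    using assms unfolding tdfn_def by blast
  then show ?thesis unfolding dfn_def by (intro exI[of _ "Eq s t"]) simp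
qed

lemma dfn_rename: assumes "dfn P" shows "dfn (\<lambda>e. P (\<lambda>i. e (\<sigma> i)))"
proof -
  obtain \<phi> where "wf_fm ar par \<phi>" "\<forall>e. sat FI PI e \<phi> \<longleftrightarrow> P e" using assms unfolding dfn_def by blast
  then show ?thesis unfolding dfn_def using sat_rename[of ar par \<phi> FI PI \<sigma>] by simp
qed

text \<open>Quantification in de Bruijn style: the bound element is put in front of the environment.\<close>

lemma dfn_ex: assumes "dfn (\<lambda>e. Q (\<lambda>i. e (Suc i)) (e 0))" shows "dfn (\<lambda>e. \<exists>x. Q e x)"
proof -
  obtain \<phi> where \<phi>: "wf_fm ar par \<phi>" "\<forall>e. sat FI PI e \<phi> \<longleftrightarrow> Q (\<lambda>i. e (Suc i)) (e 0)"
    using assms unfolding dfn_def by blast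
  \<comment> \<open>In the renamed formula the variable \<open>Suc k\<close> becomes
    \<open>k\<close>; the binder \<open>j\<close> must capture none of these.\<close>
  obtain j where j: "Suc j \<notin> fv_fm \<phi>"
  proof -
    have "finite ((\<lambda>k. k - 1) ` fv_fm \<phi>)" by (simp add: finite_fv_fm)
    then obtain j where "j \<notin> (\<lambda>k. k - 1) ` fv_fm \<phi>" using ex_new_if_finite[OF infinite_UNIV_nat] by blast
    then have "Suc j \<notin> fv_fm \<phi>" by force
    then show ?thesis using that by blast
  qed
  obtain \<phi>' where \<phi>': "wf_fm ar par \<phi>'"
    "\<forall>e. sat FI PI e \<phi>' \<longleftrightarrow> sat FI PI (\<lambda>i. e (case i of 0 \<Rightarrow> j | Suc k \<Rightarrow> k)) \<phi>"
    using sat_rename[OF \<phi>(1)] by blast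
  have "sat FI PI (\<lambda>i. (e(j := x)) (case i of 0 \<Rightarrow> j | Suc k \<Rightarrow> k)) \<phi> = sat FI PI (case_nat x e) \<phi>" for e x
    using j by (intro sat_cong) (auto split: nat.split)
  then have "sat FI PI e (Ex j \<phi>') \<longleftrightarrow> (\<exists>x. sat FI PI (case_nat x e) \<phi>)" for e
    using \<phi>'(2) by simp
  then have "sat FI PI e (Ex j \<phi>') \<longleftrightarrow> (\<exists>x. Q e x)" for e
    using \<phi>(2) by simp
  then show ?thesis unfolding dfn_def using \<phi>'(1) by (intro exI[of _ "Ex j \<phi>'"]) simp
qed

lemma dfn_all: assumes "dfn (\<lambda>e. Q (\<lambda>i. e (Suc i)) (e 0))" shows "dfn (\<lambda>e. \<forall>x. Q e x)"
  using dfn_not[OF dfn_ex[where Q = "\<lambda>e x. \<not> Q e x"]] dfn_not[OF assms] by simp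

lemma dfn_all_less: "(\<And>i::nat. i < n \<Longrightarrow> dfn (P i)) \<Longrightarrow> dfn (\<lambda>e. \<forall>i<n. P i e)"
proof (induction n)
  case (Suc n)
  then have "dfn (\<lambda>e. (\<forall>i<n. P i e) \<and> P n e)" by (intro dfn_conj) auto
  then show ?case by (simp add: All_less_Suc conj_commute)
qed (simp add: dfn_True)

lemma dfn_ex_list:
  "dfn (\<lambda>e. Q (\<lambda>i. e (i + m)) (map e [0..<m])) \<Longrightarrow> dfn (\<lambda>e. \<exists>ys. length ys = m \<and> Q e ys)"
proof (induction m arbitrary: Q)
  case (Suc m)
  have eq: "map e [0..<Suc m] = e 0 # map (\<lambda>i. e (Suc i)) [0..<m]" for e :: "nat \<Rightarrow> 'a"
    by (simp add: upt_conv_Cons map_Suc_upt[symmetric] o_def del: upt_Suc)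
  have "dfn (\<lambda>e. Q (\<lambda>i. e (i + m + 1)) (e m # map e [0..<m]))"
  proof -
    \<comment> \<open>With the head quantified outside the tail, the head ends up at index
      \<open>m\<close> and the tail at the indices below \<open>m\<close>. This renaming moves the
      head to the front of the list.\<close>
    let ?\<sigma> = "\<lambda>i. if i = 0 then m else if i \<le> m then i - 1 else i"
    have "map (\<lambda>i. e (?\<sigma> i)) [0..<Suc m] = e m # map e [0..<m]" for e :: "nat \<Rightarrow> 'a"
      unfolding eq by auto
    then show ?thesis using dfn_rename[OF Suc.prems, of ?\<sigma>] by (simp del: upt_Suc)
  qed
  then have "dfn (\<lambda>e. \<exists>ys. length ys = m \<and> Q (\<lambda>i. e (Suc i)) (e 0 # ys))"
    by (intro Suc.IH) simp
  then have "dfn (\<lambda>e. \<exists>x ys. length ys = m \<and> Q e (x # ys))"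
    by (rule dfn_ex)
  moreover have "(\<exists>x ys. length ys = m \<and> Q e (x # ys)) \<longleftrightarrow> (\<exists>ys. length ys = Suc m \<and> Q e ys)" for e
    by (auto simp: length_Suc_conv)
  ultimately show ?case by simp
qed simp

end

context ring_structure
begin

lemma tdfn_rename: assumes "tdfn u" shows "tdfn (\<lambda>e. u (\<lambda>i. e (\<sigma> i)))"
proof -
  obtain t where "wf_trm ar t" "\<forall>e. teval FI e t = u e" using assms unfolding tdfn_def by blast
  then show ?thesis unfolding tdfn_def
    by (intro exI[of _ "ren_trm \<sigma> t"]) (simp add: wf_ren_trm teval_ren_trm)
qed

text \<open>Variables are singled out among the terms because the given formula \<open>phi\<close>
  is only ever renamed; compound terms are never substituted into it.\<close>

definition proj :: "((nat \<Rightarrow> 'a) \<Rightarrow> 'a) \<Rightarrow> bool" where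
  "proj x \<longleftrightarrow> (\<exists>j. x = (\<lambda>e. e j))"

definition projs :: "nat \<Rightarrow> ((nat \<Rightarrow> 'a) \<Rightarrow> 'a list) \<Rightarrow> bool" where
  "projs n F \<longleftrightarrow> (\<exists>js. length js = n \<and> F = (\<lambda>e. map e js))"

lemma proj_var: "proj (\<lambda>e. e j)"
  unfolding proj_def by blast

lemma proj_rename: "proj x \<Longrightarrow> proj (\<lambda>e. x (\<lambda>i. e (\<sigma> i)))"
  unfolding proj_def by blast

lemma projs_map: "length js = n \<Longrightarrow> projs n (\<lambda>e. map e js)"
  unfolding projs_def by blast

lemma projs_rename: "projs n F \<Longrightarrow> projs n (\<lambda>e. F (\<lambda>i. e (\<sigma> i)))"
proof -
  assume "projs n F"
  then obtain js where js: "length js = n" "F = (\<lambda>e. map e js)" unfolding projs_def by blast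
  then have "F (\<lambda>i. e (\<sigma> i)) = map e (map \<sigma> js)" for e by simp
  then show ?thesis using js unfolding projs_def by (intro exI[of _ "map \<sigma> js"]) (simp add: o_def)
qed

lemma projs_nth: "projs n F \<Longrightarrow> i < n \<Longrightarrow> proj (\<lambda>e. F e ! i)"
  unfolding projs_def proj_def by (metis nth_map)

lemma projs_Nil: "projs 0 (\<lambda>e. [])"
  unfolding projs_def by simp

lemma projs_Cons: "proj x \<Longrightarrow> projs n G \<Longrightarrow> projs (Suc n) (\<lambda>e. x e # G e)"
  unfolding projs_def proj_def by (metis length_Cons list.simps(9))

lemma projs_hd: "projs (Suc n) G \<Longrightarrow> proj (\<lambda>e. hd (G e))"
  unfolding projs_def proj_def by (metis length_Suc_conv list.sel(1) list.simps(9))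

lemma projs_tl: "projs (Suc n) G \<Longrightarrow> projs n (\<lambda>e. tl (G e))"
  unfolding projs_def by (metis length_tl diff_Suc_1 map_tl)

lemmas rename_Suc = tdfn_rename[where \<sigma> = Suc] proj_rename[where \<sigma> = Suc] projs_rename[where \<sigma> = Suc]

lemma tdfn_proj: "proj x \<Longrightarrow> tdfn x"
  unfolding proj_def using tdfn_var by blast

lemma dfn_dvd: assumes "tdfn u" "tdfn v" shows "dfn (\<lambda>e. u e dvd v e)"
  unfolding dvd_def
  by (intro dfn_ex dfn_eq tdfn_mult tdfn_var rename_Suc assms)

lemma dfn_comaximal: assumes "tdfn u" "tdfn v" shows "dfn (\<lambda>e. comaximal (u e) (v e))"
  unfolding comaximal_iff
  by (intro dfn_ex dfn_eq tdfn_add tdfn_mult tdfn_var tdfn_one rename_Suc assms)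

lemma dfn_ball:
  assumes "dfn (\<lambda>e. e 0 \<in> A (\<lambda>i. e (Suc i)))" "dfn (\<lambda>e. Q (\<lambda>i. e (Suc i)) (e 0))"
  shows "dfn (\<lambda>e. \<forall>x\<in>A e. Q e x)"
  unfolding Ball_def by (intro dfn_all dfn_imp assms)

lemma dfn_bex:
  assumes "dfn (\<lambda>e. e 0 \<in> A (\<lambda>i. e (Suc i)))" "dfn (\<lambda>e. Q (\<lambda>i. e (Suc i)) (e 0))"
  shows "dfn (\<lambda>e. \<exists>x\<in>A e. Q e x)"
  unfolding Bex_def by (intro dfn_ex dfn_conj assms)

end

section \<open>Definability of chains and of computations in them\<close>

locale family = ring_structure ar par FI PI
  for ar :: "'f \<Rightarrow> nat" and par :: "'p \<Rightarrow> nat"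
    and FI :: "'f \<Rightarrow> 'a::idom list \<Rightarrow> 'a" and PI :: "'p \<Rightarrow> 'a list \<Rightarrow> bool" +
  fixes phi :: "('f, 'p) fm" and K :: nat
  assumes wf_phi: "wf_fm ar par phi" and fv_phi: "fv_fm phi \<subseteq> {..K}"
    and infinite_ring: "infinite (UNIV :: 'a set)"
    and cond1: "cond1 TYPE('a)" and cond2: "cond2 TYPE('a)"
    and large: "\<And>N. \<exists>qs. length qs = K \<and> finite {x. sat FI PI (env_of (x # qs) (\<lambda>_. 0)) phi} \<and>
      N \<le> card {x. sat FI PI (env_of (x # qs) (\<lambda>_. 0)) phi}"
begin

text \<open>A chain is given by a list \<open>[c, s, g, h] @ qs\<close>: the parameters \<open>qs\<close> select a member of the family,
  \<open>c, s, g\<close> code pairs, and \<open>h\<close> codes the order.\<close>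

definition M :: nat where "M = 4 + K"

definition Xs :: "'a list \<Rightarrow> 'a set" where
  "Xs ps = {x. sat FI PI (env_of (x # drop 4 ps) (\<lambda>_. 0)) phi}"

definition Ts :: "'a list \<Rightarrow> 'a \<Rightarrow> 'a \<Rightarrow> 'a" where
  "Ts ps a b = 1 + (ps ! 1 + a + ps ! 0 * b) * ps ! 2"

definition Ls :: "'a list \<Rightarrow> 'a \<Rightarrow> 'a \<Rightarrow> bool" where
  "Ls ps a b \<longleftrightarrow> Ts ps a b dvd ps ! 3"

abbreviation "chain_in ps \<equiv> chain (Xs ps) (Ts ps) (Ls ps)"
abbreviation "zero_in ps \<equiv> is_zero (Xs ps) (Ls ps)"
abbreviation "succ_in ps \<equiv> is_succ (Xs ps) (Ls ps)"
abbreviation "num_in ps \<equiv> num (Xs ps) (Ls ps)"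
abbreviation "computes_in ps \<equiv> computes (Xs ps) (Ts ps) (Ls ps)"

lemma dfn_Xs: assumes "projs M F" "proj x" shows "dfn (\<lambda>e. x e \<in> Xs (F e))"
proof -
  obtain js where js: "length js = M" "F = (\<lambda>e. map e js)" using assms(1) unfolding projs_def by blast
  obtain j where j: "x = (\<lambda>e. e j)" using assms(2) unfolding proj_def by blast
  let ?\<sigma> = "\<lambda>i. case i of 0 \<Rightarrow> j | Suc k \<Rightarrow> js ! (4 + k)"
  have "dfn (\<lambda>e. sat FI PI e phi)" unfolding dfn_def using wf_phi by blast
  then have "dfn (\<lambda>e. sat FI PI (\<lambda>i. e (?\<sigma> i)) phi)" by (rule dfn_rename)
  moreover have "sat FI PI (\<lambda>i. e (?\<sigma> i)) phi \<longleftrightarrow> x e \<in> Xs (F e)" for e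
    unfolding Xs_def mem_Collect_eq
  proof (rule sat_cong)
    fix i assume "i \<in> fv_fm phi"
    then have "i \<le> K" using fv_phi by blast
    then show "e (?\<sigma> i) = env_of (x e # drop 4 (F e)) (\<lambda>_. 0) i"
      using js j by (cases i) (auto simp: env_of_def M_def)
  qed
  ultimately show ?thesis by simp
qed

lemma tdfn_Ts:
  assumes "projs M F" "tdfn x" "tdfn y" shows "tdfn (\<lambda>e. Ts (F e) (x e) (y e))"
proof -
  have "tdfn (\<lambda>e. F e ! i)" if "i < 4" for i
    using that by (intro tdfn_proj projs_nth[OF assms(1)]) (simp add: M_def)
  then show ?thesis
    unfolding Ts_def by (intro tdfn_add tdfn_mult tdfn_one assms) auto
qed

lemma dfn_Ls: "projs M F \<Longrightarrow> proj x \<Longrightarrow> proj y \<Longrightarrow> dfn (\<lambda>e. Ls (F e) (x e) (y e))"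
  unfolding Ls_def by (intro dfn_dvd tdfn_Ts tdfn_proj projs_nth[where n = M]) (auto simp: M_def)

lemma dfn_zero: "projs M F \<Longrightarrow> proj x \<Longrightarrow> dfn (\<lambda>e. zero_in (F e) (x e))"
  unfolding is_zero_def
  by (intro dfn_conj dfn_ball dfn_Xs dfn_Ls proj_var rename_Suc)

lemma dfn_succ: "projs M F \<Longrightarrow> proj x \<Longrightarrow> proj y \<Longrightarrow> dfn (\<lambda>e. succ_in (F e) (x e) (y e))"
  unfolding is_succ_def
  by (intro dfn_conj dfn_ball dfn_imp dfn_disj dfn_not dfn_Xs dfn_Ls proj_var dfn_eq tdfn_proj rename_Suc)

lemma dfn_chain: assumes F: "projs M F" shows "dfn (\<lambda>e. chain_in (F e))"
  unfolding chain_def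
  by (intro dfn_conj dfn_ball dfn_ex dfn_bex dfn_imp dfn_disj dfn_not dfn_Xs dfn_Ls dfn_zero dfn_succ
      dfn_comaximal dfn_dvd tdfn_Ts tdfn_one proj_var dfn_eq tdfn_var rename_Suc F)

text \<open>The recursion on \<open>f\<close> runs outside the logic, for argument lists of a fixed
  length. Composition becomes a block of quantifiers, and a primitive recursion a single quantifier
  over the element \<open>h\<close> that codes its history.\<close>

lemma dfn_computes:
  "projs M F \<Longrightarrow> projs n G \<Longrightarrow> proj y \<Longrightarrow> dfn (\<lambda>e. computes_in (F e) f (G e) (y e))"
proof (induction f arbitrary: F G y n)
  case Zr
  then show ?case by (simp add: dfn_zero)
next
  case Sc
  have len: "length (G e) = n" for e using Sc(2) by (auto simp: projs_def)
  show ?case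
  proof (cases n)
    case 0
    then show ?thesis using len by (simp add: dfn_False)
  next
    case (Suc k)
    then have "G e \<noteq> []" for e using len by (metis list.size(3) nat.simps(3))
    then show ?thesis using Sc Suc by (auto intro: dfn_succ projs_hd)
  qed
next
  case (Pj i)
  have len: "length (G e) = n" for e using Pj(2) by (auto simp: projs_def)
  then show ?case using Pj
    by (cases "i < n") (auto simp: dfn_False intro!: dfn_eq tdfn_proj projs_nth)
next
  case (Cn g fs)
  let ?m = "length fs"
  have eq: "computes_in (F e) (Cn g fs) (G e) (y e) \<longleftrightarrow> (\<exists>ys. length ys = ?m \<and>
      ((\<forall>i<?m. computes_in (F e) (fs ! i) (G e) (ys ! i)) \<and> computes_in (F e) g ys (y e)))" for e
  proof -
    have "list_all2 (\<lambda>R v. R (G e) v) (map (computes_in (F e)) fs) ys \<longleftrightarrow>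
      length ys = ?m \<and> (\<forall>i<?m. computes_in (F e) (fs ! i) (G e) (ys ! i))" for ys
      by (auto simp: list_all2_conv_all_nth)
    then show ?thesis by (simp only: computes.simps conj_assoc)
  qed
  show ?case unfolding eq
  proof (intro dfn_ex_list dfn_conj dfn_all_less)
    show "dfn (\<lambda>e. computes_in (F (\<lambda>i. e (i + ?m))) g (map e [0..<?m]) (y (\<lambda>i. e (i + ?m))))"
      by (intro Cn.IH(1)[of _ ?m] projs_map projs_rename[where \<sigma> = "\<lambda>i. i + ?m"]
          proj_rename[where \<sigma> = "\<lambda>i. i + ?m"] Cn.prems) simp
    fix i assume i: "i < ?m"
    have "proj (\<lambda>e. map e [0..<?m] ! i)" using i by (simp add: proj_var)
    then show "dfn (\<lambda>e. computes_in (F (\<lambda>i. e (i + ?m))) (fs ! i) (G (\<lambda>i. e (i + ?m))) (map e [0..<?m] ! i))"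
      by (intro Cn.IH(2)[of "fs ! i" _ n] nth_mem i projs_rename[where \<sigma> = "\<lambda>i. i + ?m"] Cn.prems)
  qed
next
  case (Pr f g)
  have len: "length (G e) = n" for e using Pr(4) by (auto simp: projs_def)
  show ?case
  proof (cases n)
    case 0
    then show ?thesis using len by (simp add: dfn_False)
  next
    case (Suc k)
    then have ne: "G e \<noteq> []" for e using len by (metis list.size(3) nat.simps(3))
    have h: "proj (\<lambda>e. hd (G e))" and t: "projs k (\<lambda>e. tl (G e))"
      using Pr(4) Suc by (auto intro: projs_hd projs_tl)
    show ?thesis unfolding computes.simps
      by (intro dfn_conj dfn_ex dfn_ball dfn_imp dfn_disj dfn_bex dfn_dvd tdfn_Ts tdfn_var dfn_Xs dfn_zero dfn_succ
          Pr.IH(1)[of _ k] Pr.IH(2)[of _ "Suc (Suc k)"] projs_Cons proj_var tdfn_proj rename_Suc Pr.prems h t) (simp add: ne dfn_True)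
  qed
next
  case (Mn f)
  show ?case unfolding computes.simps
    by (intro dfn_conj dfn_ex dfn_ball dfn_imp dfn_not dfn_eq dfn_Xs dfn_Ls dfn_zero dfn_succ
          Mn.IH[of _ "Suc n"] projs_Cons proj_var tdfn_proj rename_Suc Mn.prems)
qed

end

section \<open>Undecidability\<close>

lemma enc_trm_inj:
  assumes "inj cf" shows "enc_trm cf s = enc_trm cf t \<Longrightarrow> s = t"
proof (induction s arbitrary: t)
  case (Var i)
  then show ?case by (cases t) auto
next
  case (Fn f ss)
  then obtain g ts where t: "t = Fn g ts" by (cases t) auto
  have "f = g" using Fn(2) assms t by (auto dest: injD)
  moreover have m: "map (enc_trm cf) ss = map (enc_trm cf) ts" using Fn(2) t by (auto simp: list_encode_eq)
  have "ss = ts"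
  proof (rule nth_equalityI)
    show "length ss = length ts" using m by (metis length_map)
    fix i assume i: "i < length ss"
    then have "enc_trm cf (ss ! i) = enc_trm cf (ts ! i)" using m by (metis length_map nth_map)
    then show "ss ! i = ts ! i" using Fn(1) i by simp
  qed
  ultimately show ?case using t by simp
qed

text \<open>Needed to pass from membership of a code in the theory to the truth of the very sentence
  that was encoded.\<close>

lemma enc_fm_inj:
  assumes "inj cf" "inj cp" shows "enc_fm cf cp \<phi> = enc_fm cf cp \<psi> \<Longrightarrow> \<phi> = \<psi>"
proof (induction \<phi> arbitrary: \<psi>)
  case FF
  then show ?case by (cases \<psi>) auto
next
  case (Eq s t)
  then show ?case by (cases \<psi>) (auto dest: enc_trm_inj[OF assms(1)])
next
  case (Rel p ts)
  then obtain q us where \<psi>: "\<psi> = Rel q us" by (cases \<psi>) auto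
  have "inj (enc_trm cf)" using enc_trm_inj[OF assms(1)] by (auto intro: injI)
  then have "inj (map (enc_trm cf))" by (rule list.inj_map)
  then show ?case using Rel \<psi> assms(2) by (auto simp: list_encode_eq dest: injD)
next
  case (Imp \<phi>1 \<phi>2)
  then show ?case by (cases \<psi>) auto
next
  case (Ex i \<phi>)
  then show ?case by (cases \<psi>) auto
qed

section \<open>Computability of the syntactic operations on codes\<close>

definition computable :: "(nat \<Rightarrow> nat) \<Rightarrow> bool" where
  "computable h \<longleftrightarrow> (\<exists>f. \<forall>n. reval f [n] (h n))"

lemma reval_Cn: "list_all2 (\<lambda>f y. reval f xs y) fs ys \<Longrightarrow> reval g ys y \<Longrightarrow> reval (Cn g fs) xs y"
  by (rule reval.intros(4)) (auto simp: list_all2_conv_all_nth)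

lemma reval_Pj: "i < length xs \<Longrightarrow> y = xs ! i \<Longrightarrow> reval (Pj i) xs y"
  using reval.intros(3) by blast

primrec const_recf :: "nat \<Rightarrow> recf" where
  "const_recf 0 = Zr"
| "const_recf (Suc n) = Cn Sc [const_recf n]"

lemma reval_const: "reval (const_recf n) xs n"
  by (induction n) (auto intro: reval.intros(1,2) reval_Cn[of _ _ "[n]" for n])

definition "add_recf = Pr (Pj 0) (Cn Sc [Pj 1])"

lemma reval_add: "reval add_recf [m, n] (m + n)"
proof (induction m)
  case 0
  show ?case unfolding add_recf_def by (auto intro!: reval.intros(5) reval_Pj)
next
  case (Suc m)
  have "reval (Cn Sc [Pj 1]) [m, m + n, n] (Suc (m + n))"
    by (rule reval_Cn[of _ _ "[m + n]"]) (auto intro!: reval_Pj reval.intros(2))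
  then show ?case using Suc unfolding add_recf_def by (auto intro: reval.intros(6))
qed

text \<open>Pairing is \<open>prod_encode (a, b) = triangle (a + b) + a\<close>, so sums and
  triangular numbers suffice to compute it.\<close>

definition "triangle_recf = Pr Zr (Cn Sc [Cn add_recf [Pj 0, Pj 1]])"

lemma reval_triangle: "reval triangle_recf [n] (triangle n)"
proof (induction n)
  case 0
  show ?case unfolding triangle_recf_def by (auto intro!: reval.intros(5) reval.intros(1))
next
  case (Suc n)
  have "reval (Cn add_recf [Pj 0, Pj 1]) [n, triangle n] (n + triangle n)"
    by (rule reval_Cn[of _ _ "[n, triangle n]"]) (auto intro!: reval_Pj reval_add)
  then have "reval (Cn Sc [Cn add_recf [Pj 0, Pj 1]]) [n, triangle n] (Suc (n + triangle n))"
    by (intro reval_Cn[of _ _ "[n + triangle n]"]) (auto intro!: reval.intros(2))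
  then show ?case using Suc unfolding triangle_recf_def
    by (auto intro: reval.intros(6) simp: add.commute)
qed

lemma computable_const: "computable (\<lambda>n. c)"
  unfolding computable_def using reval_const by blast

lemma computable_id: "computable (\<lambda>n. n)"
  unfolding computable_def by (intro exI[of _ "Pj 0"]) (auto intro!: reval_Pj)

lemma computable_comp: assumes "computable g" "computable h" shows "computable (\<lambda>n. g (h n))"
proof -
  obtain G H where "\<forall>n. reval G [n] (g n)" "\<forall>n. reval H [n] (h n)"
    using assms unfolding computable_def by blast
  then have "reval (Cn G [H]) [n] (g (h n))" for n
    by (intro reval_Cn[of _ _ "[h n]"]) auto
  then show ?thesis unfolding computable_def by blast
qed

lemma computable_add: assumes "computable g" "computable h" shows "computable (\<lambda>n. g n + h n)"
proof -
  obtain G H where "\<forall>n. reval G [n] (g n)" "\<forall>n. reval H [n] (h n)"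
    using assms unfolding computable_def by blast
  then have "reval (Cn add_recf [G, H]) [n] (g n + h n)" for n
    by (intro reval_Cn[of _ _ "[g n, h n]"]) (auto intro: reval_add)
  then show ?thesis unfolding computable_def by blast
qed

lemma computable_pair:
  assumes "computable g" "computable h" shows "computable (\<lambda>n. prod_encode (g n, h n))"
proof -
  have "computable triangle" unfolding computable_def using reval_triangle by blast
  then have "computable (\<lambda>n. triangle (g n + h n))"
    by (rule computable_comp) (rule computable_add[OF assms])
  then show ?thesis unfolding prod_encode_def prod.case by (rule computable_add) (rule assms(1))
qed

lemma computable_iter: assumes "computable h" shows "computable (\<lambda>n. (h ^^ n) c)"
proof -
  obtain H where H: "\<forall>n. reval H [n] (h n)" using assms unfolding computable_def by blast
  have "reval (Pr (const_recf c) (Cn H [Pj 1])) [n] ((h ^^ n) c)" for n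
  proof (induction n)
    case 0
    show ?case by (auto intro: reval.intros(5) reval_const)
  next
    case (Suc n)
    have "reval (Cn H [Pj 1]) [n, (h ^^ n) c] (h ((h ^^ n) c))"
      using H by (intro reval_Cn[of _ _ "[(h ^^ n) c]"]) (auto intro!: reval_Pj)
    then show ?case using Suc by (auto intro: reval.intros(6))
  qed
  then show ?thesis unfolding computable_def by blast
qed

definition and_code :: "nat \<Rightarrow> nat \<Rightarrow> nat" where
  "and_code a b = prod_encode (3, prod_encode (prod_encode (3, prod_encode (a,
     prod_encode (3, prod_encode (b, prod_encode (0, 0))))), prod_encode (0, 0)))"

definition ex_code :: "nat \<Rightarrow> nat \<Rightarrow> nat" where
  "ex_code i a = prod_encode (4, prod_encode (i, a))"

lemma enc_And: "enc_fm cf cp (And \<phi> \<psi>) = and_code (enc_fm cf cp \<phi>) (enc_fm cf cp \<psi>)"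
  by (simp add: and_code_def)

lemma enc_foldr_Ex: "enc_fm cf cp (foldr Ex vs \<phi>) = foldr ex_code vs (enc_fm cf cp \<phi>)"
  by (induction vs) (auto simp: ex_code_def)

lemma computable_and_code: "computable g \<Longrightarrow> computable h \<Longrightarrow> computable (\<lambda>n. and_code (g n) (h n))"
  unfolding and_code_def by (intro computable_pair computable_const)

lemma computable_ex_code: "computable h \<Longrightarrow> computable (\<lambda>n. ex_code i (h n))"
  unfolding ex_code_def by (intro computable_pair computable_const)

lemma computable_foldr_ex_code: "computable h \<Longrightarrow> computable (\<lambda>n. foldr ex_code vs (h n))"
  by (induction vs) (auto intro: computable_ex_code)

text \<open>The syntactic free variables are cut down to the semantically relevant ones by quantifying
  the others away.\<close>

lemma (in ring_structure) dfn_bounded: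
  assumes "dfn P" "\<And>e e'. (\<And>i. i < B \<Longrightarrow> e i = e' i) \<Longrightarrow> P e = P e'"
  obtains \<phi> where "wf_fm ar par \<phi>" "fv_fm \<phi> \<subseteq> {..<B}" "\<And>e. sat FI PI e \<phi> \<longleftrightarrow> P e"
proof -
  obtain \<phi> where \<phi>: "wf_fm ar par \<phi>" "\<forall>e. sat FI PI e \<phi> \<longleftrightarrow> P e" using assms(1) unfolding dfn_def by blast
  let ?vs = "sorted_list_of_set (fv_fm \<phi> - {..<B})"
  have vs: "set ?vs = fv_fm \<phi> - {..<B}" by (simp add: finite_fv_fm)
  have "sat FI PI e (foldr Ex ?vs \<phi>) \<longleftrightarrow> P e" for e
  proof -
    have "P e' = P e" if "\<forall>i. i \<notin> set ?vs \<longrightarrow> e' i = e i" for e'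
      using that vs by (intro assms(2)) simp
    then show ?thesis unfolding sat_foldr_Ex using \<phi>(2) by blast
  qed
  moreover have "fv_fm (foldr Ex ?vs \<phi>) \<subseteq> {..<B}" using vs by (auto simp: fv_foldr_Ex)
  moreover have "wf_fm ar par (foldr Ex ?vs \<phi>)" using \<phi>(1) by (simp add: wf_foldr_Ex)
  ultimately show ?thesis using that by blast
qed

section \<open>Long chains and the diagonal argument\<close>

context family
begin

lemma long_chain_ex: "\<exists>ps. length ps = M \<and> chain_in ps \<and> finite (Xs ps) \<and> (\<exists>x. num_in ps N x)"
proof -
  \<comment> \<open>\<open>Suc N\<close> elements are required because positions start at 0.\<close>
  obtain qs where qs: "length qs = K" "finite {x. sat FI PI (env_of (x # qs) (\<lambda>_. 0)) phi}"
      "Suc N \<le> card {x. sat FI PI (env_of (x # qs) (\<lambda>_. 0)) phi}" using large by blast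
  let ?X = "{x. sat FI PI (env_of (x # qs) (\<lambda>_. 0)) phi}"
  have "?X \<noteq> {}" using qs(3) by (metis card.empty not_less_eq_eq zero_le)
  then obtain c s g h where ch:
    "chain ?X (\<lambda>a b. 1 + (s + a + c * b) * g) (\<lambda>a b. (1 + (s + a + c * b) * g) dvd h)"
    by (rule chain_ex[OF infinite_ring cond1 cond2 qs(2)])
  let ?ps = "c # s # g # h # qs"
  have X: "Xs ?ps = ?X" by (simp add: Xs_def)
  have T: "Ts ?ps = (\<lambda>a b. 1 + (s + a + c * b) * g)" by (intro ext) (simp add: Ts_def)
  have L: "Ls ?ps = (\<lambda>a b. (1 + (s + a + c * b) * g) dvd h)" unfolding Ls_def T by (simp add: numeral_3_eq_3)
  have g: "chain_in ?ps" unfolding X T L by (rule ch)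
  have "\<exists>x. num_in ?ps N x"
    using chain.num_long[OF g] qs(3) unfolding X by simp
  then show ?thesis using g qs X by (intro exI[of _ ?ps]) (simp add: M_def)
qed

lemma computes_in_complete:
  assumes "reval f ns m"
  shows "\<exists>ps. length ps = M \<and> chain_in ps \<and> finite (Xs ps) \<and> (\<exists>x. num_in ps N x) \<and>
    (\<forall>xs. list_all2 (num_in ps) ns xs \<longrightarrow> (\<exists>y. num_in ps m y \<and> computes_in ps f xs y))"
proof -
  obtain N0 where N0: "\<And>n (X::'a set) T L. N0 \<le> n \<Longrightarrow> chain X T L \<Longrightarrow> (\<exists>x. num X L n x) \<Longrightarrow>
     (\<forall>xs. list_all2 (num X L) ns xs \<longrightarrow> (\<exists>y. num X L m y \<and> computes X T L f xs y))"
    using computes_complete[OF assms, where ?'a = 'a] unfolding eventually_sequentially by blast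
  obtain ps where ps: "length ps = M" "chain_in ps" "finite (Xs ps)" "\<exists>x. num_in ps (max N N0) x"
    using long_chain_ex by blast
  then have "\<exists>x. num_in ps N x" using chain.num_mono[OF ps(2)] by (metis max.cobounded1)
  moreover have "\<forall>xs. list_all2 (num_in ps) ns xs \<longrightarrow> (\<exists>y. num_in ps m y \<and> computes_in ps f xs y)"
    by (rule N0[of "max N N0"]) (use ps in auto)
  ultimately show ?thesis using ps by blast
qed

lemma undecidable: "undecidable_theory ar par FI PI"
  unfolding undecidable_theory_def
proof (intro allI impI notI)
  fix cf :: "'f \<Rightarrow> nat" and cp :: "'p \<Rightarrow> nat"
  assume inj: "inj cf" "inj cp" and dec: "rec_decidable (theory_codes cf cp ar par FI PI)"
  let ?enc = "enc_fm cf cp" and ?Th = "theory_codes cf cp ar par FI PI"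
  obtain f where f: "\<And>k. k \<in> ?Th \<Longrightarrow> reval f [k] 1" "\<And>k. k \<notin> ?Th \<Longrightarrow> reval f [k] 0"
    using dec unfolding rec_decidable_def by blast
  \<comment> \<open>Variable 0 holds an element, variables 1 to \<open>M\<close> the parameters of
    its chain, and \<open>Suc M\<close> is auxiliary. Free variables are kept within these bounds so
    that quantifying over 0 to \<open>M\<close> yields a closed sentence in the end.\<close>
  let ?ps = "\<lambda>e::nat \<Rightarrow> 'a. map e [1..<Suc M]"
  have projs_ps: "projs M ?ps" by (rule projs_map) simp
  have ps_cong: "?ps e = ?ps e'" if "\<And>i. 1 \<le> i \<Longrightarrow> i \<le> M \<Longrightarrow> e i = e' i" for e e' using that by auto
  obtain Z where Z: "wf_fm ar par Z" "fv_fm Z \<subseteq> {..<Suc M}" "\<And>e. sat FI PI e Z \<longleftrightarrow> zero_in (?ps e) (e 0)"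
  proof (rule dfn_bounded[of "\<lambda>e. zero_in (?ps e) (e 0)" "Suc M"])
    fix e e' :: "nat \<Rightarrow> 'a" assume e: "\<And>i. i < Suc M \<Longrightarrow> e i = e' i"
    have p: "?ps e = ?ps e'" by (rule ps_cong) (simp add: e)
    show "zero_in (?ps e) (e 0) = zero_in (?ps e') (e' 0)" unfolding p by (simp only: e[of 0] zero_less_Suc)
  qed (use projs_ps in \<open>auto intro: dfn_zero proj_var\<close>)
  obtain S where S: "wf_fm ar par S" "fv_fm S \<subseteq> {..<Suc (Suc M)}"
    "\<And>e. sat FI PI e S \<longleftrightarrow> succ_in (?ps e) (e (Suc M)) (e 0)"
  proof (rule dfn_bounded[of "\<lambda>e. succ_in (?ps e) (e (Suc M)) (e 0)" "Suc (Suc M)"])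
    fix e e' :: "nat \<Rightarrow> 'a" assume e: "\<And>i. i < Suc (Suc M) \<Longrightarrow> e i = e' i"
    have p: "?ps e = ?ps e'" by (rule ps_cong) (simp add: e)
    show "succ_in (?ps e) (e (Suc M)) (e 0) = succ_in (?ps e') (e' (Suc M)) (e' 0)"
      unfolding p by (simp only: e[of 0] e[of "Suc M"] zero_less_Suc lessI)
  qed (use projs_ps in \<open>auto intro: dfn_succ proj_var\<close>)
  (* diag k codes the sentence "some chain has a k-th element satisfying the formula with code k" *)
  define step :: "('f, 'p) fm \<Rightarrow> ('f, 'p) fm" where
    "step \<phi> = Ex (Suc M) (And S (Ex 0 (And (Eq (Var 0) (Var (Suc M))) \<phi>)))" for \<phi>
  \<comment> \<open>In \<open>step\<close> the predecessor, found as variable \<open>Suc M\<close>,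
    is copied into the rebound variable 0. No renaming of the previous formula occurs, so the code
    of \<open>Nu n\<close> arises by iterating one computable function on codes.\<close>
  define Nu where "Nu n = (step ^^ n) Z" for n
  define step_code where
    "step_code k = ex_code (Suc M) (and_code (?enc S) (ex_code 0 (and_code (?enc (Eq (Var 0) (Var (Suc M)))) k)))" for k
  define diag where "diag k = foldr ex_code [0..<Suc M] (and_code ((step_code ^^ k) (?enc Z)) k)" for k
  have wf_Nu: "wf_fm ar par (Nu n)" for n
    unfolding Nu_def by (induction n) (auto simp: step_def Z S)
  have fv_Nu: "fv_fm (Nu n) \<subseteq> {..<Suc M}" for n
  proof (induction n)
    case 0
    then show ?case using Z by (simp add: Nu_def)
  next
    case (Suc n)
    have "Nu (Suc n) = step (Nu n)" by (simp add: Nu_def)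
    then show ?case using Suc S(2) by (auto simp: step_def lessThan_Suc)
  qed
  have sat_Nu: "sat FI PI e (Nu n) \<longleftrightarrow> num_in (?ps e) n (e 0)" for n e
  proof (induction n arbitrary: e)
    case 0
    then show ?case using Z by (simp add: Nu_def del: upt_Suc)
  next
    case (Suc n)
    have eq: "Nu (Suc n) = step (Nu n)" by (simp add: Nu_def)
    have p: "?ps (e(Suc M := x)) = ?ps e" "?ps (e(Suc M := x, 0 := x)) = ?ps e" for x
      by (rule ps_cong, simp)+
    have "sat FI PI e (step (Nu n)) \<longleftrightarrow>
      (\<exists>x. sat FI PI (e(Suc M := x)) S \<and> sat FI PI (e(Suc M := x, 0 := x)) (Nu n))"
      by (simp add: step_def)
    also have "\<dots> \<longleftrightarrow> (\<exists>x. succ_in (?ps e) x (e 0) \<and> num_in (?ps e) n x)"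
      unfolding S(3) Suc.IH p by simp
    finally show ?case unfolding eq num.simps by blast
  qed
  have enc_Nu: "?enc (Nu n) = (step_code ^^ n) (?enc Z)" for n
  proof (induction n)
    case (Suc n)
    have "Nu (Suc n) = step (Nu n)" by (simp add: Nu_def)
    then show ?case using Suc
      by (simp add: step_def step_code_def enc_And ex_code_def del: enc_fm.simps(4))
  qed (simp add: Nu_def)
  have "computable step_code" unfolding step_code_def
    by (intro computable_ex_code computable_and_code computable_const computable_id)
  then have "computable diag" unfolding diag_def
    by (intro computable_foldr_ex_code computable_and_code computable_iter computable_id)
  then obtain d where d: "\<And>k. reval d [k] (diag k)" unfolding computable_def by blast
  \<comment> \<open>Applied to \<open>k\<close>, \<open>F\<close> gives the verdict of the supposed
    decision procedure \<open>f\<close> on the sentence with code \<open>diag k\<close>.\<close>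
  define F where "F = Cn f [d]"
  have F: "reval f [diag k] b \<Longrightarrow> reval F [k] b" for k b
    unfolding F_def using d by (intro reval_Cn[of _ _ "[diag k]"]) auto
  obtain \<psi> where \<psi>: "wf_fm ar par \<psi>" "fv_fm \<psi> \<subseteq> {..<Suc M}"
    "\<And>e. sat FI PI e \<psi> \<longleftrightarrow> chain_in (?ps e) \<and> (\<exists>z. zero_in (?ps e) z \<and> computes_in (?ps e) F [e 0] z)"
  proof (rule dfn_bounded[of "\<lambda>e. chain_in (?ps e) \<and> (\<exists>z. zero_in (?ps e) z \<and> computes_in (?ps e) F [e 0] z)" "Suc M"])
    show "dfn (\<lambda>e. chain_in (?ps e) \<and> (\<exists>z. zero_in (?ps e) z \<and> computes_in (?ps e) F [e 0] z))"
      by (intro dfn_conj dfn_ex dfn_chain[OF projs_ps] dfn_zero dfn_computes[of _ "Suc 0"] projs_Cons projs_Nil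
          proj_var rename_Suc(3)[OF projs_ps])
    fix e e' :: "nat \<Rightarrow> 'a" assume e: "\<And>i. i < Suc M \<Longrightarrow> e i = e' i"
    have p: "?ps e = ?ps e'" by (rule ps_cong) (simp add: e)
    show "(chain_in (?ps e) \<and> (\<exists>z. zero_in (?ps e) z \<and> computes_in (?ps e) F [e 0] z)) =
      (chain_in (?ps e') \<and> (\<exists>z. zero_in (?ps e') z \<and> computes_in (?ps e') F [e' 0] z))"
      unfolding p by (simp only: e[of 0] zero_less_Suc)
  qed blast
  define m where "m = ?enc \<psi>"
  \<comment> \<open>Self-reference: \<open>m\<close> is the code of \<open>\<psi>\<close>, hence
    \<open>\<sigma>\<close> has code \<open>diag m\<close> and states that \<open>F\<close> has
    value 0 at \<open>m\<close>, as computed in some chain.\<close>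
  define \<sigma> where "\<sigma> = foldr Ex [0..<Suc M] (And (Nu m) \<psi>)"
  have enc_\<sigma>: "?enc \<sigma> = diag m"
    unfolding \<sigma>_def diag_def enc_foldr_Ex enc_And enc_Nu m_def ..
  have wf_\<sigma>: "wf_fm ar par \<sigma>" by (simp add: \<sigma>_def wf_foldr_Ex wf_Nu \<psi>(1) del: upt_Suc)
  have fv_\<sigma>: "fv_fm \<sigma> = {}"
    using fv_Nu[of m] \<psi>(2) by (auto simp: \<sigma>_def fv_foldr_Ex simp del: upt_Suc)
  have sat_\<sigma>: "sat FI PI e \<sigma> \<longleftrightarrow> (\<exists>e'. (\<forall>i. M < i \<longrightarrow> e' i = e i) \<and> num_in (?ps e') m (e' 0) \<and>
      chain_in (?ps e') \<and> (\<exists>z. zero_in (?ps e') z \<and> computes_in (?ps e') F [e' 0] z))" for e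
    unfolding \<sigma>_def sat_foldr_Ex by (simp add: sat_Nu \<psi>(3) not_less_eq del: upt_Suc)
  show False
  proof (cases "diag m \<in> ?Th")
    case True
    \<comment> \<open>If \<open>\<sigma>\<close> is accepted, it is true, and some chain computes 0
      where the actual value is 1; this contradicts soundness.\<close>
    then have R: "reval F [m] 1" using f(1) F by blast
    obtain \<phi> where "?enc \<sigma> = ?enc \<phi>" "\<forall>e. sat FI PI e \<phi>"
      using True unfolding theory_codes_def enc_\<sigma> by blast
    then have "\<forall>e. sat FI PI e \<sigma>" using enc_fm_inj[OF inj] by blast
    then obtain e z where e: "num_in (?ps e) m (e 0)" "chain_in (?ps e)" "zero_in (?ps e) z"
      "computes_in (?ps e) F [e 0] z" unfolding sat_\<sigma> by blast
    have "num_in (?ps e) 1 z" using chain.computes_sound[OF e(2) R _ e(4)] e(1) by simp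
    moreover have "num_in (?ps e) 0 z" using e(3) by simp
    ultimately show False using chain.num_inj[OF e(2)] zero_neq_one by blast
  next
    case False
    \<comment> \<open>If \<open>\<sigma>\<close> is rejected, a sufficiently long chain has an
      \<open>m\<close>-th element and computes 0 there, which makes \<open>\<sigma>\<close>
      true.\<close>
    then have R: "reval F [m] 0" using f(2) F by blast
    obtain ps where ps: "length ps = M" "chain_in ps" "\<exists>x. num_in ps m x"
        "\<forall>xs. list_all2 (num_in ps) [m] xs \<longrightarrow> (\<exists>y. num_in ps 0 y \<and> computes_in ps F xs y)"
      using computes_in_complete[OF R] by blast
    then obtain x where x: "num_in ps m x" by blast
    then obtain z where z: "zero_in ps z" "computes_in ps F [x] z" using ps(4) by (metis list.rel_inject(2) list.rel_intros(1) num.simps(1))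
    have "sat FI PI e \<sigma>" for e
    proof -
      let ?e = "\<lambda>i. if i \<le> M then (x # ps) ! i else e i"
      have "?ps ?e = ps" using ps(1) by (auto intro!: nth_equalityI simp del: upt_Suc)
      then show ?thesis unfolding sat_\<sigma> using x z ps by (intro exI[of _ ?e]) (auto simp del: upt_Suc)
    qed
    then have "?enc \<sigma> \<in> ?Th" unfolding theory_codes_def using wf_\<sigma> fv_\<sigma> by blast
    then show False using False enc_\<sigma> by simp
  qed
qed

end

section \<open>Interpreting the theory R\<close>

definition "mult_recf = Pr Zr (Cn add_recf [Pj 1, Pj 2])"

lemma reval_mult: "reval mult_recf [m, n] (m * n)"
proof (induction m)
  case 0
  show ?case unfolding mult_recf_def by (auto intro!: reval.intros(5) reval.intros(1))
next
  case (Suc m)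
  have "reval (Cn add_recf [Pj 1, Pj 2]) [m, m * n, n] (m * n + n)"
    by (rule reval_Cn[of _ _ "[m * n, n]"]) (auto intro!: reval_Pj reval_add)
  then show ?case using Suc unfolding mult_recf_def
    by (auto intro: reval.intros(6) simp: add.commute)
qed

section \<open>Addition and multiplication inside a single chain\<close>

context chain
begin

lemma computes_add_zero:
  "is_zero X L z \<Longrightarrow> w \<in> X \<Longrightarrow> r \<in> X \<Longrightarrow> computes X T L add_recf [z, w] r \<longleftrightarrow> r = w"
  unfolding add_recf_def using computes_Pr_zero[of z r "Pj 0" "Cn Sc [Pj 1]" "[w]"] by (simp del: computes.simps(5))

lemma computes_add_succ:
  "is_succ X L m n \<Longrightarrow> r \<in> X \<Longrightarrow>
    computes X T L add_recf [n, w] r \<longleftrightarrow> (\<exists>v. computes X T L add_recf [m, w] v \<and> is_succ X L v r)"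
  unfolding add_recf_def using computes_Pr_succ[of m n r "Pj 0" "Cn Sc [Pj 1]" "[w]"] succ_carrier
  by (auto simp: list_all2_Cons1 simp del: computes.simps(5))

lemma computes_add_in: "computes X T L add_recf xs r \<Longrightarrow> r \<in> X"
  by (simp add: add_recf_def)

lemma computes_mult_in: "computes X T L mult_recf xs r \<Longrightarrow> r \<in> X"
  by (simp add: mult_recf_def)

text \<open>The recursion runs on \<open>u\<close>, whose standard position permits induction;
  \<open>w\<close> may be nonstandard.\<close>

lemma computes_add_unique:
  assumes "num X L n u" "w \<in> X"
  shows "computes X T L add_recf [u, w] r \<Longrightarrow> computes X T L add_recf [u, w] r' \<Longrightarrow> r = r'"
  using assms(1)
proof (induction n arbitrary: u r r')
  case 0
  then show ?case using computes_add_zero[OF _ assms(2)] computes_add_in by (metis num.simps(1))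
next
  case (Suc n)
  then obtain t where t: "num X L n t" "is_succ X L t u" by auto
  obtain v where v: "computes X T L add_recf [t, w] v" "is_succ X L v r"
    using Suc.prems(1) computes_add_succ[OF t(2) computes_add_in[OF Suc.prems(1)]] by blast
  obtain v' where v': "computes X T L add_recf [t, w] v'" "is_succ X L v' r'"
    using Suc.prems(2) computes_add_succ[OF t(2) computes_add_in[OF Suc.prems(2)]] by blast
  have "v = v'" using Suc.IH[OF v(1) v'(1) t(1)] .
  then show ?case using v(2) v'(2) succ_unique by blast
qed

lemma computes_add_num:
  "num X L k u \<Longrightarrow> num X L n w \<Longrightarrow> num X L (k + n) r \<Longrightarrow> computes X T L add_recf [u, w] r"
proof (induction k arbitrary: u r)
  case 0
  have "r = w" using 0 num_unique by simp
  then show ?case using computes_add_zero[of u w r] 0 num_carrier by auto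
next
  case (Suc k)
  then obtain t v where t: "num X L k t" "is_succ X L t u" and v: "num X L (k + n) v" "is_succ X L v r"
    by auto
  have "computes X T L add_recf [t, w] v" using Suc.IH[OF t(1) Suc.prems(2) v(1)] .
  then show ?case using computes_add_succ[OF t(2) num_carrier[OF Suc.prems(3)]] v(2) by blast
qed

lemma computes_mult_num:
  "num X L k u \<Longrightarrow> num X L n w \<Longrightarrow> (\<And>i. \<exists>y. num X L i y) \<Longrightarrow> num X L (k * n) r \<Longrightarrow> computes X T L mult_recf [u, w] r"
proof (induction k arbitrary: u r)
  case 0
  then show ?case unfolding mult_recf_def using computes_Pr_zero[of u r Zr] num_carrier[OF 0(4)] 0(1,4) by (simp del: computes.simps(5))
next
  case (Suc k)
  then obtain t where t: "num X L k t" "is_succ X L t u" by auto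
  obtain v where v: "num X L (k * n) v" using Suc.prems(3) by blast
  have "computes X T L mult_recf [t, w] v" using Suc.IH t v Suc.prems by blast
  moreover have "computes X T L add_recf [v, w] r"
    using computes_add_num[OF v Suc.prems(2)] Suc.prems(4) by (simp only: mult_Suc add.commute)
  then have "computes X T L (Cn add_recf [Pj 1, Pj 2]) [t, v, w] r"
    by (auto simp: list_all2_Cons1)
  ultimately show ?case unfolding mult_recf_def
    using computes_Pr_succ[OF t(2) num_carrier[OF Suc.prems(4)]] num_carrier[OF v] by blast
qed

text \<open>Subtraction: \<open>u\<close> and \<open>x\<close> step down together until
  \<open>u\<close> reaches the least element. Only \<open>u\<close> has to be standard.\<close>

lemma computes_add_sub:
  "num X L n u \<Longrightarrow> L u x \<Longrightarrow> x \<in> X \<Longrightarrow> \<exists>w\<in>X. computes X T L add_recf [u, w] x"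
proof (induction n arbitrary: u x)
  case 0
  then show ?case using computes_add_zero by auto
next
  case (Suc n)
  then obtain t where t: "num X L n t" "is_succ X L t u" by auto
  have "\<not> is_zero X L x"
    using Suc.prems(2,3) t(2) L_antisym zero_not_succ succ_carrier unfolding is_zero_def by metis
  then obtain y where y: "is_succ X L y x" using pred_ex Suc.prems(3) by blast
  have "L t y"
  proof (rule ccontr)
    assume "\<not> L t y"
    then have "L y t" "t \<noteq> y" using L_total L_refl t(2) y succ_carrier by blast+
    then have "L x t" using y t(2) succ_carrier unfolding is_succ_def by blast
    then have "L u t" using Suc.prems(2,3) L_trans t(2) succ_carrier by blast
    then show False using t(2) L_antisym unfolding is_succ_def by blast
  qed
  then obtain w where "w \<in> X" "computes X T L add_recf [t, w] y" using Suc.IH[OF t(1)] y succ_carrier by blast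
  then show ?case using computes_add_succ[OF t(2) Suc.prems(3)] y by blast
qed

end

text \<open>The default value \<open>u\<close> keeps \<open>u\<close> below the sum of \<open>w\<close> and \<open>u\<close> in an infinite chain, so that
  a sum can be standard only if its second argument is.\<close>

definition total_op :: "('b \<Rightarrow> 'b \<Rightarrow> 'b \<Rightarrow> bool) \<Rightarrow> 'b \<Rightarrow> 'b \<Rightarrow> 'b" where
  "total_op P w u = (if \<exists>!r. P w u r then THE r. P w u r else u)"

lemma total_op_eq: "P w u r \<Longrightarrow> (\<And>r'. P w u r' \<Longrightarrow> r' = r) \<Longrightarrow> total_op P w u = r"
  unfolding total_op_def by (metis (mono_tags, lifting) the_equality)

lemma total_op_cases: "P w u (total_op P w u) \<or> total_op P w u = u"
  unfolding total_op_def using theI'[of "P w u"] by simp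

text \<open>A form free of \<open>\<exists>!\<close> and \<open>THE\<close>, to which the rules for
  \<open>dfn\<close> apply directly.\<close>

lemma total_op_graph:
  "total_op P w u = r \<longleftrightarrow>
    (\<exists>y. P w u y \<and> (\<forall>y'. P w u y' \<longrightarrow> y' = y) \<and> r = y) \<or>
    \<not> (\<exists>y. P w u y \<and> (\<forall>y'. P w u y' \<longrightarrow> y' = y)) \<and> r = u"
proof (cases "\<exists>!r. P w u r")
  case True
  then obtain y where "P w u y" "\<And>y'. P w u y' \<Longrightarrow> y' = y" by blast
  then show ?thesis using total_op_eq[of P w u y] by blast
next
  case False
  then show ?thesis unfolding total_op_def by auto
qed

text \<open>Modulo \<open>E\<close> this is the standard model: \<open>ix\<close> gives the number
  denoted by an element, \<open>rep\<close> picks a representative, and the operations are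
  transported along them.\<close>

lemma setoid_model_standard:
  assumes "\<And>x y. x \<in> D \<Longrightarrow> y \<in> D \<Longrightarrow> E x y \<longleftrightarrow> ix x = ix y"
    and "\<And>n::nat. rep n \<in> D" "\<And>n. ix (rep n) = n"
  shows "setoid_model_R D E (rep 0) (\<lambda>x. rep (Suc (ix x))) (\<lambda>x y. rep (ix x + ix y)) (\<lambda>x y. rep (ix x * ix y))"
proof -
  have num: "numeral_R (rep 0) (\<lambda>x. rep (Suc (ix x))) n = rep n" for n
    by (induction n) (auto simp: assms(3))
  have le: "\<exists>w\<in>D. E (rep (ix w + ix u)) v" if "v \<in> D" "ix u \<le> ix v" for u v
    using that assms by (intro bexI[of _ "rep (ix v - ix u)"]) auto
  have R4: "\<exists>i\<le>n. E x (rep i)" if "x \<in> D" "w \<in> D" "E (rep (ix w + ix x)) (rep n)" for x w n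
    using that assms by (intro exI[of _ "ix x"]) auto
  have R5: "(\<exists>w\<in>D. E (rep (ix w + ix x)) (rep n)) \<or> (\<exists>w\<in>D. E (rep (ix w + ix (rep n))) x)"
    if "x \<in> D" for x n
    using le[of "rep n" x] le[of x "rep n"] that assms(2,3) by fastforce
  show ?thesis
    unfolding setoid_model_R_def Let_def num
    by (intro conjI allI ballI impI R5; (elim bexE, rule R4)?) (simp_all add: assms)
qed

text \<open>The one-dimensional case, with equality as \<open>E\<close>. The map \<open>q\<close>
  enumerates the numerals; \<open>below\<close> and \<open>linear\<close> yield the two order axioms
  of R.\<close>

lemma setoid_model_singletons:
  assumes q: "\<And>n. q n \<in> X" "inj q" and "q 0 = z" "\<And>n. s (q n) = q (Suc n)"
    and "\<And>x. x \<in> X \<Longrightarrow> s x \<in> X"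
    and "\<And>x y. x \<in> X \<Longrightarrow> y \<in> X \<Longrightarrow> a x y \<in> X" "\<And>x y. x \<in> X \<Longrightarrow> y \<in> X \<Longrightarrow> m x y \<in> X"
    and add: "\<And>n k. a (q n) (q k) = q (n + k)" and mult: "\<And>n k. m (q n) (q k) = q (n * k)"
    and below: "\<And>w x n. w \<in> X \<Longrightarrow> x \<in> X \<Longrightarrow> a w x = q n \<Longrightarrow> \<exists>i\<le>n. x = q i"
    and linear: "\<And>x n. x \<in> X \<Longrightarrow> (\<exists>w\<in>X. a w x = q n) \<or> (\<exists>w\<in>X. a w (q n) = x)"
    and E: "\<And>x y. x \<in> X \<Longrightarrow> y \<in> X \<Longrightarrow> E [x] [y] \<longleftrightarrow> x = y"
  shows "setoid_model_R ((\<lambda>x. [x]) ` X) E [z] (\<lambda>x. [s (hd x)]) (\<lambda>x y. [a (hd x) (hd y)]) (\<lambda>x y. [m (hd x) (hd y)])"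
proof -
  have num: "numeral_R [z] (\<lambda>x. [s (hd x)]) n = [q n]" for n
    by (induction n) (auto simp: assms)
  have z: "z \<in> X" using assms(1)[of 0] assms(3) by simp
  show ?thesis
    unfolding setoid_model_R_def Let_def num
    using z below linear by (auto simp: assms inj_eq[OF q(2)])
qed

context family
begin

lemma interprets_infinite:
  assumes "length ps = M" "chain_in ps" "infinite (Xs ps)"
  shows "interprets_R ar par FI PI"
proof -
  interpret C: chain "Xs ps" "Ts ps" "Ls ps" by (rule assms(2))
  have "\<exists>x. num_in ps n x" for n using C.num_long assms(3) by blast
  then obtain q where q: "\<And>n. num_in ps n (q n)" by metis
  have q_in: "q n \<in> Xs ps" for n using q C.num_carrier by blast
  have q_eq: "num_in ps n x \<longleftrightarrow> x = q n" for n x using q C.num_unique by blast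
  have q_inj: "inj q" using q C.num_inj by (metis injI)
  \<comment> \<open>The recursion is on the second summand because \<open>\<Delta>_n \<le> x\<close>
    asks for some \<open>w\<close> with \<open>w + \<Delta>_n = x\<close>, where \<open>w\<close>
    and \<open>x\<close> may be nonstandard. By the conjunct \<open>Ls ps u r\<close> and the
    default value, the result is never below \<open>u\<close>.\<close>
  define add where "add = total_op (\<lambda>w u r. computes_in ps add_recf [u, w] r \<and> Ls ps u r)"
  define mult where "mult = total_op (\<lambda>w u r. computes_in ps mult_recf [u, w] r)"
  define suc where "suc x = total_op (\<lambda>w u r. succ_in ps u r) x x" for x
  \<comment> \<open>Variables 0, 1 and 2 are reserved for the arguments; the fixed chain is a
    parameter stored from index 3 on.\<close>
  let ?ps = "\<lambda>e::nat \<Rightarrow> 'a. map e [3..<3 + M]"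
  have projs_ps: "projs M ?ps" by (rule projs_map) simp
  note dfns = dfn_disj dfn_conj dfn_ex dfn_not dfn_all dfn_imp dfn_eq dfn_Xs dfn_Ls dfn_zero dfn_succ
    dfn_computes[where n = "Suc (Suc 0)"] projs_Cons projs_Nil proj_var tdfn_var projs_ps rename_Suc
  have "dfn (\<lambda>e. e 0 \<in> Xs (?ps e))" by (intro dfns)
  then obtain dD where dD: "wf_fm ar par dD" "\<And>e. sat FI PI e dD \<longleftrightarrow> e 0 \<in> Xs (?ps e)"
    unfolding dfn_def by blast
  have "dfn (\<lambda>e. e 0 = e 1)" by (intro dfns)
  then obtain dE where dE: "wf_fm ar par dE" "\<And>e. sat FI PI e dE \<longleftrightarrow> e 0 = e 1"
    unfolding dfn_def by blast
  have "dfn (\<lambda>e. zero_in (?ps e) (e 0))" by (intro dfns)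
  then obtain dZ where dZ: "wf_fm ar par dZ" "\<And>e. sat FI PI e dZ \<longleftrightarrow> zero_in (?ps e) (e 0)"
    unfolding dfn_def by blast
  have "dfn (\<lambda>e. total_op (\<lambda>w u r. succ_in (?ps e) u r) (e 0) (e 0) = e 1)"
    unfolding total_op_graph by (intro dfns)
  then obtain dS where dS: "wf_fm ar par dS"
    "\<And>e. sat FI PI e dS \<longleftrightarrow> total_op (\<lambda>w u r. succ_in (?ps e) u r) (e 0) (e 0) = e 1"
    unfolding dfn_def by blast
  have "dfn (\<lambda>e. total_op (\<lambda>w u r. computes_in (?ps e) add_recf [u, w] r \<and> Ls (?ps e) u r) (e 0) (e 1) = e 2)"
    unfolding total_op_graph by (intro dfns)
  then obtain dA where dA: "wf_fm ar par dA"
    "\<And>e. sat FI PI e dA \<longleftrightarrow> total_op (\<lambda>w u r. computes_in (?ps e) add_recf [u, w] r \<and> Ls (?ps e) u r) (e 0) (e 1) = e 2"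
    unfolding dfn_def by blast
  have "dfn (\<lambda>e. total_op (\<lambda>w u r. computes_in (?ps e) mult_recf [u, w] r) (e 0) (e 1) = e 2)"
    unfolding total_op_graph by (intro dfns)
  then obtain dM where dM: "wf_fm ar par dM"
    "\<And>e. sat FI PI e dM \<longleftrightarrow> total_op (\<lambda>w u r. computes_in (?ps e) mult_recf [u, w] r) (e 0) (e 1) = e 2"
    unfolding dfn_def by blast
  define e where "e i = ps ! (i - 3)" for i
  have ps: "?ps (env_of xs e) = ps" if "length xs \<le> 3" for xs
    using assms(1) that by (auto intro!: nth_equalityI simp: env_of_def e_def)
  have add_q: "add (q n) (q k) = q (n + k)" for n k
    unfolding add_def
  proof (rule total_op_eq)
    have "computes_in ps add_recf [q k, q n] (q (k + n))" using C.computes_add_num q by blast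
    moreover have "Ls ps (q k) (q (k + n))"
      using C.num_less[OF q q, of k "k + n"] C.L_refl[OF q_in] by (cases "n = 0") auto
    ultimately show "computes_in ps add_recf [q k, q n] (q (n + k)) \<and> Ls ps (q k) (q (n + k))"
      by (simp add: add.commute)
    show "r = q (n + k)" if "computes_in ps add_recf [q k, q n] r \<and> Ls ps (q k) r" for r
      using C.computes_sound[OF reval_add, of k n "[q k, q n]" r] that q q_eq by (simp add: add.commute)
  qed
  have mult_q: "mult (q n) (q k) = q (n * k)" for n k
    unfolding mult_def
  proof (rule total_op_eq)
    show "computes_in ps mult_recf [q k, q n] (q (n * k))"
      by (rule C.computes_mult_num[of k _ n]) (use q in \<open>auto simp: mult.commute\<close>)
    show "r = q (n * k)" if "computes_in ps mult_recf [q k, q n] r" for r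
      using C.computes_sound[OF reval_mult, of k n "[q k, q n]" r] that q q_eq by (simp add: mult.commute)
  qed
  have suc_q: "suc (q n) = q (Suc n)" for n
  proof -
    have "succ_in ps (q n) (q (Suc n))" using q[of "Suc n"] q_eq by auto
    then show ?thesis unfolding suc_def using C.succ_unique by (intro total_op_eq) blast+
  qed
  have suc_in: "suc x \<in> Xs ps" if "x \<in> Xs ps" for x
    using total_op_cases[of "\<lambda>w u r. succ_in ps u r" x x] that C.succ_carrier unfolding suc_def by metis
  have add_cases: "computes_in ps add_recf [u, w] (add w u) \<and> Ls ps u (add w u) \<or> add w u = u" for w u
    unfolding add_def by (rule total_op_cases)
  have add_in: "add x y \<in> Xs ps" if "x \<in> Xs ps" "y \<in> Xs ps" for x y
    using add_cases[of y x] C.computes_add_in that by auto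
  have mult_in: "mult x y \<in> Xs ps" if "x \<in> Xs ps" "y \<in> Xs ps" for x y
    using total_op_cases[of "\<lambda>w u r. computes_in ps mult_recf [u, w] r" x y] C.computes_mult_in that
    unfolding mult_def by metis
  have below: "\<exists>i\<le>n. x = q i" if "x \<in> Xs ps" "Ls ps x (q n)" for x n
  proof (cases "Ls ps (q n) x")
    case True
    then show ?thesis using that C.L_antisym q_in by blast
  next
    case False
    then show ?thesis using C.num_below[OF q that(1), of n] q_eq by (metis less_imp_le)
  qed
  have model: "setoid_model_R ((\<lambda>x. [x]) ` Xs ps) (\<lambda>xs ys. sat FI PI (env_of (xs @ ys) e) dE) [q 0]
     (\<lambda>x. [suc (hd x)]) (\<lambda>x y. [add (hd x) (hd y)]) (\<lambda>x y. [mult (hd x) (hd y)])"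
  proof (rule setoid_model_singletons[of q])
    show "\<exists>i\<le>n. x = q i" if "w \<in> Xs ps" "x \<in> Xs ps" "add w x = q n" for w x n
      using add_cases[of x w] that below[of x n] by auto
    show "(\<exists>w\<in>Xs ps. add w x = q n) \<or> (\<exists>w\<in>Xs ps. add w (q n) = x)" if x: "x \<in> Xs ps" for x n
    proof (cases "Ls ps (q n) x")
      case True
      then obtain w where w: "w \<in> Xs ps" "computes_in ps add_recf [q n, w] x"
        using C.computes_add_sub q x by blast
      \<comment> \<open>The computed sum is unique since \<open>q n\<close> is standard, and it lies
        above \<open>q n\<close> by the case assumption, so \<open>total_op\<close> returns
        it.\<close>
      then have "add w (q n) = x" unfolding add_def
        using True C.computes_add_unique[OF q w(1)] by (intro total_op_eq) blast+
      then show ?thesis using w by blast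
    next
      case False
      then obtain i where "i \<le> n" "x = q i" using below x C.L_total q_in by blast
      then have "add (q (n - i)) x = q n" by (simp add: add_q)
      then show ?thesis using q_in by blast
    qed
  qed (use q_in q_inj suc_q add_q mult_q suc_in add_in mult_in dE in \<open>auto simp: env_of_def\<close>)
  have D: "{xs. length xs = 1 \<and> sat FI PI (env_of xs e) dD} = (\<lambda>x. [x]) ` Xs ps"
  proof -
    have "sat FI PI (env_of [x] e) dD \<longleftrightarrow> x \<in> Xs ps" for x
      using ps[of "[x]"] by (simp add: dD env_of_def del: upt_Suc)
    then show ?thesis by (auto simp: length_Suc_conv)
  qed
  have E: "sat FI PI (env_of [x, y] e) dE \<longleftrightarrow> x = y" for x y by (simp add: dE env_of_def)
  have Z: "sat FI PI (env_of [x] e) dZ \<longleftrightarrow> q 0 = x" for x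
    using ps[of "[x]"] q_eq[of 0 x] by (auto simp: dZ env_of_def)
  have S: "sat FI PI (env_of [x, y] e) dS \<longleftrightarrow> suc x = y" for x y
    using ps[of "[x, y]"] by (simp add: dS suc_def) (simp add: env_of_def)
  have A: "sat FI PI (env_of [x, y, w] e) dA \<longleftrightarrow> add x y = w" for x y w
    using ps[of "[x, y, w]"] by (simp add: dA add_def) (simp add: env_of_def)
  have Mu: "sat FI PI (env_of [x, y, w] e) dM \<longleftrightarrow> mult x y = w" for x y w
    using ps[of "[x, y, w]"] by (simp add: dM mult_def) (simp add: env_of_def)
  show ?thesis
    unfolding interprets_R_def Let_def
  proof (rule exI[of _ 1], rule exI[of _ dD], rule exI[of _ dE], rule exI[of _ dZ], rule exI[of _ dS],
      rule exI[of _ dA], rule exI[of _ dM], rule exI[of _ e], intro exI conjI)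
    show "setoid_model_R {xs. length xs = 1 \<and> sat FI PI (env_of xs e) dD}
      (\<lambda>xs ys. sat FI PI (env_of (xs @ ys) e) dE) [q 0]
     (\<lambda>x. [suc (hd x)]) (\<lambda>x y. [add (hd x) (hd y)]) (\<lambda>x y. [mult (hd x) (hd y)])"
      unfolding D by (rule model)
  qed (use D dD(1) dE(1) dZ(1) dS(1) dA(1) dM(1) E Z S A Mu in auto)
qed

end

section \<open>Positions in finite chains as a copy of the natural numbers\<close>

context family
begin

text \<open>An element of the domain is a list \<open>x # ps\<close>: a position \<open>x\<close> in the chain \<open>Xs ps\<close>.\<close>

definition position :: "'a list \<Rightarrow> nat \<Rightarrow> bool" where
  "position xs n \<longleftrightarrow> length xs = Suc M \<and> chain_in (tl xs) \<and> finite (Xs (tl xs)) \<and> num_in (tl xs) n (hd xs)"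

text \<open>Two positions agree iff a coded set of pairs, closed under predecessors, contains them.\<close>

definition same_pos :: "'a list \<Rightarrow> 'a list \<Rightarrow> bool" where
  "same_pos xs ys \<longleftrightarrow> (\<exists>c s g h. (1 + (s + hd xs + c * hd ys) * g) dvd h \<and>
     (\<forall>a\<in>Xs (tl xs). \<forall>b\<in>Xs (tl ys). (1 + (s + a + c * b) * g) dvd h \<longrightarrow>
        zero_in (tl xs) a \<and> zero_in (tl ys) b \<or>
        (\<exists>a'\<in>Xs (tl xs). \<exists>b'\<in>Xs (tl ys). succ_in (tl xs) a' a \<and> succ_in (tl ys) b' b \<and>
          (1 + (s + a' + c * b') * g) dvd h)))"

lemma position_unique: "position xs n \<Longrightarrow> position xs m \<Longrightarrow> n = m"
  unfolding position_def using chain.num_inj by blast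

text \<open>Descending from the two heads through the coded set, both coordinates must reach the
  least elements simultaneously, which forces equal positions. Conversely, both chains are finite,
  so the pairs at equal positions form a finite set, which has a code.\<close>

lemma same_pos_iff:
  assumes "position xs n" "position ys m" shows "same_pos xs ys \<longleftrightarrow> n = m"
proof -
  let ?A = "Xs (tl xs)" and ?B = "Xs (tl ys)"
  interpret A: chain ?A "Ts (tl xs)" "Ls (tl xs)" using assms(1) by (simp add: position_def)
  interpret B: chain ?B "Ts (tl ys)" "Ls (tl ys)" using assms(2) by (simp add: position_def)
  have hd: "num_in (tl xs) n (hd xs)" "num_in (tl ys) m (hd ys)" using assms by (auto simp: position_def)
  show ?thesis
  proof
    assume "same_pos xs ys"
    then obtain c s g h where st: "(1 + (s + hd xs + c * hd ys) * g) dvd h"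
      and cl: "\<forall>a\<in>?A. \<forall>b\<in>?B. (1 + (s + a + c * b) * g) dvd h \<longrightarrow>
        zero_in (tl xs) a \<and> zero_in (tl ys) b \<or>
        (\<exists>a'\<in>?A. \<exists>b'\<in>?B. succ_in (tl xs) a' a \<and> succ_in (tl ys) b' b \<and> (1 + (s + a' + c * b') * g) dvd h)"
      unfolding same_pos_def by blast
    have "num_in (tl ys) k b" if "num_in (tl xs) k a" "b \<in> ?B" "(1 + (s + a + c * b) * g) dvd h" for k a b
      using that
    proof (induction k arbitrary: a b)
      case 0
      have "a \<in> ?A" using A.num_carrier[OF 0(1)] .
      then show ?case using cl 0 A.zero_not_succ by auto
    next
      case (Suc k)
      have a: "a \<in> ?A" using A.num_carrier[OF Suc.prems(1)] .
      obtain t where t: "num_in (tl xs) k t" "succ_in (tl xs) t a" using Suc.prems(1) by auto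
      then have "\<not> zero_in (tl xs) a" using A.zero_not_succ by blast
      then obtain a' b' where ab: "b' \<in> ?B" "succ_in (tl xs) a' a" "succ_in (tl ys) b' b"
        "(1 + (s + a' + c * b') * g) dvd h" using cl a Suc.prems(2,3) by blast
      have "a' = t" using A.succ_inj[OF ab(2) t(2)] .
      then have "num_in (tl ys) k b'" using Suc.IH[OF _ ab(1,4)] t(1) by simp
      then show ?case using ab(3) by auto
    qed
    then have "num_in (tl ys) n (hd ys)" using hd st B.num_carrier by blast
    then show "n = m" using hd(2) B.num_inj by blast
  next
    assume "n = m"
    have fin: "finite ?A" "finite ?B" using assms by (auto simp: position_def)
    obtain c s g where
      T: "\<forall>a\<in>?A. \<forall>b\<in>?B. \<forall>a'\<in>?A. \<forall>b'\<in>?B. a \<noteq> a' \<or> b \<noteq> b' \<longrightarrow>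
         comaximal (1 + (s + a + c * b) * g) (1 + (s + a' + c * b') * g)"
      "\<forall>a\<in>?A. \<forall>b\<in>?B. \<not> (1 + (s + a + c * b) * g) dvd 1"
      by (rule pair_code[OF infinite_ring cond1 cond2 fin])
    let ?R = "{(a, b) \<in> ?A \<times> ?B. \<exists>k. num_in (tl xs) k a \<and> num_in (tl ys) k b}"
    let ?T = "\<lambda>(a, b). 1 + (s + a + c * b) * g"
    have "\<exists>h. \<forall>p\<in>?A \<times> ?B. ?T p dvd h \<longleftrightarrow> p \<in> ?R"
      by (rule subset_code) (use T fin in \<open>auto intro: finite_subset[of _ "?A \<times> ?B"]\<close>)
    then obtain h where h: "\<And>a b. a \<in> ?A \<Longrightarrow> b \<in> ?B \<Longrightarrow> (1 + (s + a + c * b) * g) dvd h \<longleftrightarrow>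
        (\<exists>k. num_in (tl xs) k a \<and> num_in (tl ys) k b)"
      by force
    have "(1 + (s + hd xs + c * hd ys) * g) dvd h"
      using h[OF A.num_carrier[OF hd(1)] B.num_carrier[OF hd(2)]] hd \<open>n = m\<close> by blast
    moreover have "zero_in (tl xs) a \<and> zero_in (tl ys) b \<or>
        (\<exists>a'\<in>?A. \<exists>b'\<in>?B. succ_in (tl xs) a' a \<and> succ_in (tl ys) b' b \<and> (1 + (s + a' + c * b') * g) dvd h)"
      if ab: "a \<in> ?A" "b \<in> ?B" "(1 + (s + a + c * b) * g) dvd h" for a b
    proof -
      obtain k where k: "num_in (tl xs) k a" "num_in (tl ys) k b" using h ab by blast
      show ?thesis
      proof (cases k)
        case 0
        then show ?thesis using k by simp
      next
        case (Suc j)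
        then obtain a' b' where "num_in (tl xs) j a'" "succ_in (tl xs) a' a" "num_in (tl ys) j b'" "succ_in (tl ys) b' b"
          using k by auto
        moreover from this have "(1 + (s + a' + c * b') * g) dvd h" using h A.num_carrier B.num_carrier by blast
        ultimately show ?thesis using A.num_carrier B.num_carrier by blast
      qed
    qed
    ultimately show "same_pos xs ys" unfolding same_pos_def by blast
  qed
qed

lemma dfn_same_pos:
  assumes "projs (Suc M) F" "projs (Suc M) G" shows "dfn (\<lambda>e. same_pos (F e) (G e))"
  unfolding same_pos_def
  by (intro dfn_ex dfn_conj dfn_disj dfn_imp dfn_ball dfn_bex dfn_dvd dfn_Xs dfn_zero dfn_succ
      tdfn_add tdfn_mult tdfn_one tdfn_var rename_Suc tdfn_proj
      projs_tl[OF assms(1)] projs_tl[OF assms(2)] projs_hd[OF assms(1)] projs_hd[OF assms(2)] proj_var)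

text \<open>The three arguments may come from different chains, each possibly too short for the
  computation. They are therefore copied into a common chain \<open>ps\<close>, in which
  \<open>f\<close> is evaluated.\<close>

definition graph :: "recf \<Rightarrow> 'a list \<Rightarrow> 'a list \<Rightarrow> 'a list \<Rightarrow> bool" where
  "graph f xs ys ws \<longleftrightarrow> (\<exists>ps. length ps = M \<and> (chain_in ps \<and> (\<exists>u v w. u \<in> Xs ps \<and> v \<in> Xs ps \<and> w \<in> Xs ps \<and>
     same_pos (u # ps) xs \<and> same_pos (v # ps) ys \<and> same_pos (w # ps) ws \<and> computes_in ps f [u, v] w)))"

lemma dfn_graph:
  assumes "projs (Suc M) F" "projs (Suc M) G" "projs (Suc M) H"
  shows "dfn (\<lambda>e. graph f (F e) (G e) (H e))"
proof -
  have "projs M (\<lambda>e. map e [0..<M])" by (rule projs_map) simp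
  then show ?thesis unfolding graph_def
    by (intro dfn_ex_list dfn_conj dfn_ex dfn_chain dfn_Xs dfn_same_pos dfn_computes[where n = "Suc (Suc 0)"]
        projs_Cons projs_Nil proj_var rename_Suc projs_rename[where \<sigma> = "\<lambda>i. i + M"] assms)
qed

text \<open>From left to right, finiteness puts \<open>u\<close>, \<open>v\<close> and
  \<open>w\<close> at standard positions, and soundness determines the value. From right to left, a
  chain long enough for the evaluation of \<open>f\<close> supplies the witnesses.\<close>

lemma graph_iff:
  assumes fin: "\<And>ps. length ps = M \<Longrightarrow> chain_in ps \<Longrightarrow> finite (Xs ps)"
    and "position xs n" "position ys m" "position ws k" "reval f [n, m] l"
  shows "graph f xs ys ws \<longleftrightarrow> k = l"
proof
  assume "graph f xs ys ws"
  then obtain ps u v w where ps: "length ps = M" "chain_in ps" and uvw: "u \<in> Xs ps" "v \<in> Xs ps" "w \<in> Xs ps"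
    and same: "same_pos (u # ps) xs" "same_pos (v # ps) ys" "same_pos (w # ps) ws"
    and computes: "computes_in ps f [u, v] w"
    unfolding graph_def by blast
  have pos: "\<exists>i. position (a # ps) i \<and> num_in ps i a" if "a \<in> Xs ps" for a
    using chain.num_finite[OF ps(2) fin[OF ps] that] ps fin by (auto simp: position_def)
  have u: "num_in ps n u" using pos[OF uvw(1)] same_pos_iff[OF _ assms(2)] same(1) by blast
  have v: "num_in ps m v" using pos[OF uvw(2)] same_pos_iff[OF _ assms(3)] same(2) by blast
  have w: "num_in ps k w" using pos[OF uvw(3)] same_pos_iff[OF _ assms(4)] same(3) by blast
  have "num_in ps l w" using chain.computes_sound[OF ps(2) assms(5) _ computes] u v by simp
  then show "k = l" using w chain.num_inj[OF ps(2)] by blast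
next
  assume "k = l"
  obtain ps where ps: "length ps = M" "chain_in ps" "\<exists>x. num_in ps (max n m) x"
    "\<forall>xs. list_all2 (num_in ps) [n, m] xs \<longrightarrow> (\<exists>y. num_in ps l y \<and> computes_in ps f xs y)"
    using computes_in_complete[OF assms(5)] by blast
  obtain u v where uv: "num_in ps n u" "num_in ps m v"
    using ps(3) chain.num_mono[OF ps(2)] by (metis max.cobounded1 max.cobounded2)
  then obtain w where w: "num_in ps l w" "computes_in ps f [u, v] w"
    using ps(4) by (metis (no_types, lifting) list.rel_intros)
  have pos: "position (a # ps) i" if "num_in ps i a" for a i
    using that ps fin by (simp add: position_def)
  have "same_pos (u # ps) xs" "same_pos (v # ps) ys" "same_pos (w # ps) ws"
    using same_pos_iff[OF pos assms(2)] same_pos_iff[OF pos assms(3)] same_pos_iff[OF pos assms(4)]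
      uv w \<open>k = l\<close> by blast+
  then show "graph f xs ys ws" unfolding graph_def
    using ps(1,2) uv w chain.num_carrier[OF ps(2)] by blast
qed

lemma interprets_finite:
  assumes fin: "\<And>ps. length ps = M \<Longrightarrow> chain_in ps \<Longrightarrow> finite (Xs ps)"
  shows "interprets_R ar par FI PI"
proof -
  let ?N = "Suc M"
  let ?F = "\<lambda>e::nat \<Rightarrow> 'a. map e [0..<?N]" and ?G = "\<lambda>e::nat \<Rightarrow> 'a. map e [?N..<?N + ?N]"
    and ?H = "\<lambda>e::nat \<Rightarrow> 'a. map e [?N + ?N..<?N + ?N + ?N]"
  have projs: "projs ?N ?F" "projs ?N ?G" "projs ?N ?H" by (rule projs_map, simp only: length_upt diff_add_inverse diff_zero)+
  \<comment> \<open>The formula speaks of membership in a chain only; finiteness and a standard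
    position then follow from \<open>fin\<close>.\<close>
  have "dfn (\<lambda>e. chain_in (tl (?F e)) \<and> hd (?F e) \<in> Xs (tl (?F e)))"
    by (intro dfn_conj dfn_chain dfn_Xs projs_hd[OF projs(1)] projs_tl[OF projs(1)])
  then obtain dD where dD: "wf_fm ar par dD"
    "\<And>e. sat FI PI e dD \<longleftrightarrow> chain_in (tl (?F e)) \<and> hd (?F e) \<in> Xs (tl (?F e))"
    unfolding dfn_def by blast
  obtain dE where dE: "wf_fm ar par dE" "\<And>e. sat FI PI e dE \<longleftrightarrow> same_pos (?F e) (?G e)"
    using dfn_same_pos[OF projs(1,2)] unfolding dfn_def by blast
  have "dfn (\<lambda>e. zero_in (tl (?F e)) (hd (?F e)))"
    by (intro dfn_zero projs_hd[OF projs(1)] projs_tl[OF projs(1)])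
  then obtain dZ where dZ: "wf_fm ar par dZ" "\<And>e. sat FI PI e dZ \<longleftrightarrow> zero_in (tl (?F e)) (hd (?F e))"
    unfolding dfn_def by blast
  \<comment> \<open>\<open>graph\<close> takes two arguments and \<open>Sc\<close> reads the first
    one, so the argument is repeated.\<close>
  obtain dS where dS: "wf_fm ar par dS" "\<And>e. sat FI PI e dS \<longleftrightarrow> graph Sc (?F e) (?F e) (?G e)"
    using dfn_graph[OF projs(1,1,2)] unfolding dfn_def by blast
  obtain dA where dA: "wf_fm ar par dA" "\<And>e. sat FI PI e dA \<longleftrightarrow> graph add_recf (?F e) (?G e) (?H e)"
    using dfn_graph[OF projs] unfolding dfn_def by blast
  obtain dM where dM: "wf_fm ar par dM" "\<And>e. sat FI PI e dM \<longleftrightarrow> graph mult_recf (?F e) (?G e) (?H e)"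
    using dfn_graph[OF projs] unfolding dfn_def by blast
  define e where "e = (\<lambda>_::nat. 0::'a)"
  have F: "?F (env_of (xs @ zs) e) = xs" if "length xs = ?N" for xs zs
    using that by (auto intro!: nth_equalityI simp: env_of_def nth_append simp del: upt_Suc)
  have G: "?G (env_of (xs @ ys @ zs) e) = ys" if "length xs = ?N" "length ys = ?N" for xs ys zs
    using that by (auto intro!: nth_equalityI simp: env_of_def nth_append simp del: upt_Suc)
  have H: "?H (env_of (xs @ ys @ zs) e) = zs" if "length xs = ?N" "length ys = ?N" "length zs = ?N" for xs ys zs
    using that by (auto intro!: nth_equalityI simp: env_of_def nth_append simp del: upt_Suc)
  define D where "D = {xs. length xs = ?N \<and> sat FI PI (env_of xs e) dD}"
  have D: "xs \<in> D \<longleftrightarrow> (\<exists>n. position xs n)" for xs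
  proof (cases "length xs = ?N")
    case True
    have "xs \<in> D \<longleftrightarrow> chain_in (tl xs) \<and> hd xs \<in> Xs (tl xs)"
      using F[OF True, of "[]"] True by (simp add: D_def dD(2) del: upt_Suc)
    moreover have "length (tl xs) = M" using True by simp
    ultimately show ?thesis using True fin chain.num_finite chain.num_carrier
      unfolding position_def by metis
  qed (simp add: D_def position_def)
  define ix where "ix xs = (THE n. position xs n)" for xs
  have ix: "position xs n \<Longrightarrow> ix xs = n" for xs n
    unfolding ix_def using position_unique by blast
  have pos: "position xs (ix xs)" if "xs \<in> D" for xs using that D ix by metis
  have len: "length xs = ?N" if "xs \<in> D" for xs using that by (simp add: D_def)
  have "\<exists>xs. position xs n" for n
  proof -
    obtain ps x where "length ps = M" "chain_in ps" "finite (Xs ps)" "num_in ps n x" using long_chain_ex by blast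
    then show ?thesis by (intro exI[of _ "x # ps"]) (simp add: position_def)
  qed
  then obtain rep where rep: "\<And>n. position (rep n) n" by metis
  have rep_D: "rep n \<in> D" and ix_rep: "ix (rep n) = n" for n using rep D ix by blast+
  let ?E = "\<lambda>xs ys. sat FI PI (env_of (xs @ ys) e) dE"
  have E: "?E xs ys \<longleftrightarrow> ix xs = ix ys" if "xs \<in> D" "ys \<in> D" for xs ys
  proof -
    have "?G (env_of (xs @ ys) e) = ys" using G[of xs ys "[]"] len that by simp
    then show ?thesis using F[of xs ys] len that same_pos_iff[OF pos pos, of xs ys]
      by (simp only: dE(2))
  qed
  have graph: "graph f xs ys ws \<longleftrightarrow> ?E (rep l) ws"
    if "xs \<in> D" "ys \<in> D" "ws \<in> D" "reval f [ix xs, ix ys] l" for f xs ys ws l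
    using graph_iff[OF fin pos pos pos, of xs ys ws f l] that E[OF rep_D that(3)] ix_rep by auto
  show ?thesis
    unfolding interprets_R_def Let_def
  proof (rule exI[of _ ?N], rule exI[of _ dD], rule exI[of _ dE], rule exI[of _ dZ], rule exI[of _ dS],
      rule exI[of _ dA], rule exI[of _ dM], rule exI[of _ e], fold D_def, intro exI conjI ballI)
    show "setoid_model_R D ?E (rep 0) (\<lambda>x. rep (Suc (ix x))) (\<lambda>x y. rep (ix x + ix y)) (\<lambda>x y. rep (ix x * ix y))"
      using E rep_D ix_rep by (rule setoid_model_standard)
    fix x assume x: "x \<in> D"
    have "sat FI PI (env_of x e) dZ \<longleftrightarrow> position x 0"
      using F[of x "[]"] len[OF x] pos[OF x] by (simp add: dZ(2) position_def del: upt_Suc)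
    then show "sat FI PI (env_of x e) dZ \<longleftrightarrow> ?E (rep 0) x"
      using E[OF rep_D x] ix_rep ix pos[OF x] by metis
    fix y assume y: "y \<in> D"
    have "?G (env_of (x @ y) e) = y" using G[of x y "[]"] len x y by simp
    then show "sat FI PI (env_of (x @ y) e) dS \<longleftrightarrow> ?E (rep (Suc (ix x))) y"
      unfolding dS(2) F[OF len[OF x]] using graph[OF x x y reval.intros(2)] by simp
    fix w assume w: "w \<in> D"
    show "sat FI PI (env_of (x @ y @ w) e) dA \<longleftrightarrow> ?E (rep (ix x + ix y)) w"
      unfolding dA(2) F[OF len[OF x]] G[OF len[OF x] len[OF y]] H[OF len[OF x] len[OF y] len[OF w]]
      by (rule graph[OF x y w reval_add])
    show "sat FI PI (env_of (x @ y @ w) e) dM \<longleftrightarrow> ?E (rep (ix x * ix y)) w"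
      unfolding dM(2) F[OF len[OF x]] G[OF len[OF x] len[OF y]] H[OF len[OF x] len[OF y] len[OF w]]
      by (rule graph[OF x y w reval_mult])
  qed (use dD(1) dE(1) dZ(1) dS(1) dA(1) dM(1) in auto)
qed

lemma interprets: "interprets_R ar par FI PI"
  using interprets_finite interprets_infinite by blast

end

theorem theorem2p2:
  fixes ar :: "'f \<Rightarrow> nat" and par :: "'p \<Rightarrow> nat"
    and FI :: "'f \<Rightarrow> 'a::idom list \<Rightarrow> 'a" and PI :: "'p \<Rightarrow> 'a list \<Rightarrow> bool"
  assumes "infinite (UNIV :: 'a set)"
    and "cond1 TYPE('a)"
    and "cond2 TYPE('a)"
    and "expands_ring ar FI"
    and "\<exists>\<F>. unif_param ar par FI PI \<F> \<and> (\<forall>N. \<exists>F\<in>\<F>. finite F \<and> card F \<ge> N)"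
  shows "interprets_R ar par FI PI \<and> undecidable_theory ar par FI PI"
proof -
  obtain \<F> where \<F>: "unif_param ar par FI PI \<F>" "\<forall>N. \<exists>F\<in>\<F>. finite F \<and> card F \<ge> N"
    using assms(5) by blast
  obtain k and psi phi :: "('f, 'p) fm" and e where phi: "wf_fm ar par phi"
    and sets: "\<forall>F. F \<in> \<F> \<longleftrightarrow> (\<exists>ys\<in>{ys. length ys = k \<and> sat FI PI (env_of ys e) psi}.
       F = {x. sat FI PI (env_of (x # ys) e) phi})"
    using \<F>(1) unfolding unif_param_def Let_def by (elim exE conjE) (rule that)
  obtain K where K: "fv_fm phi \<subseteq> {..K}"
    using finite_fv_fm[of phi] by (meson Max_ge atMost_iff subsetI)
  have "family ar par FI PI phi K"
  proof
    show "\<exists>qs. length qs = K \<and> finite {x. sat FI PI (env_of (x # qs) (\<lambda>_. 0)) phi} \<and>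
      N \<le> card {x. sat FI PI (env_of (x # qs) (\<lambda>_. 0)) phi}" for N
    proof -
      obtain F where F: "F \<in> \<F>" "finite F" "card F \<ge> N" using \<F>(2) by blast
      then obtain ys where ys: "F = {x. sat FI PI (env_of (x # ys) e) phi}" using sets by blast
      \<comment> \<open>The entries of \<open>ys\<close> and the fixed parameters from
        \<open>e\<close> are merged into one list of length \<open>K\<close>, which covers every
        free variable of \<open>phi\<close> except variable 0.\<close>
      let ?qs = "map (\<lambda>i. env_of (undefined # ys) e (Suc i)) [0..<K]"
      have "sat FI PI (env_of (x # ?qs) (\<lambda>_. 0)) phi = sat FI PI (env_of (x # ys) e) phi" for x
      proof (rule sat_cong)
        fix i assume "i \<in> fv_fm phi"
        then have "i \<le> K" using K by blast
        then show "env_of (x # ?qs) (\<lambda>_. 0) i = env_of (x # ys) e i"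
          by (cases i) (auto simp: env_of_def)
      qed
      then show ?thesis using F ys by (intro exI[of _ ?qs]) simp
    qed
  qed (fact phi K assms)+
  then show ?thesis using family.interprets family.undecidable by blast
qed

end
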